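(* There exists $a_0>0$ such that for every $0<a<a_0$ the kernel $G_g(t,u)$ is positive definite on $L^2(-a,a)$, i.e. $\int_{-a}^a\int_{-a}^aG_g(t,u)\phi(u)\overline{\phi(t)}\,du\,dt>0$ for all non-zero $\phi\in L^2(-a,a)$. In particular, the restriction $g|_{[-2a,2a]}$ belongs to the class $\mathcal{G}_a$ for every $0<a<a_0$.
   Context: $\Lambda$ is the von Mangoldt function, $G$ is Catalan's constant, $C=\pi^2+8G$, $\Phi(z,s,a)=\sum_{n\ge0}(n+a)^{-s}z^n$. For $t\ge0$, \[\Psi(t):=4(e^{t/2}+e^{-t/2}-2)-\sum_{n\le e^t}\frac{\Lambda(n)}{\sqrt n}(t-\log n)+\frac t2\Big[\frac{\Gamma'}{\Gamma}\Big(\frac14\Big)-\log\pi\Big]+\frac14\Big(C-e^{-t/2}\Phi(e^{-2t},2,1/4)\Big),\] extended evenly to $\mathbb{R}$; $g=-\Psi$ and $G_g(t,u)=g(t-u)-g(t)-g(-u)+g(0)$. For $0<a\le\infty$, $\mathcal{G}_a$ is the class of continuous functions $h$ on $(-2a,2a)$ with $h(-t)=\overline{h(t)}$ such that $\sum_{i,j=1}^n G_h(t_i,t_j)\xi_i\overline{\xi_j}\ge0$ for all $n\in\mathbb{N}$, $\xi_i\in\mathbb{C}$, $|t_i|<a$, where $G_h(t,u)=h(t-u)-h(t)-h(-u)+h(0)$. The result is unconditional. *)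

theory Defs
  imports
    "HOL-Analysis.Analysis"
    "HOL-Number_Theory.Prime_Powers"
    "HOL-Library.Complex_Order"
begin

definition catalan_const :: real where
  "catalan_const = (\<Sum>n. (-1) ^ n / (2 * real n + 1)\<^sup>2)"

text \<open>The Lerch transcendent, given by its defining series. It is only used with
  \<open>0 < z \<le> 1\<close>, \<open>s = 2\<close>, \<open>a = 1/4\<close>, where the series converges.\<close>

definition lerch_phi :: "real \<Rightarrow> real \<Rightarrow> real \<Rightarrow> real" where
  "lerch_phi z s a = (\<Sum>n. (real n + a) powr (- s) * z ^ n)"

definition Psi_nonneg :: "real \<Rightarrow> real" where
  "Psi_nonneg t =
     4 * (exp (t / 2) + exp (- t / 2) - 2)
     - (\<Sum>n | 1 \<le> n \<and> real n \<le> exp t. mangoldt n / sqrt (real n) * (t - ln (real n)))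
     + t / 2 * (Digamma (1 / 4) - ln pi)
     + 1 / 4 * ((pi\<^sup>2 + 8 * catalan_const) - exp (- t / 2) * lerch_phi (exp (- 2 * t)) 2 (1 / 4))"

text \<open>\<open>\<Psi>\<close> is the even extension to the whole line of the formula above, which is meant for
  \<open>t \<ge> 0\<close> only.\<close>

definition Psi :: "real \<Rightarrow> real" where
  "Psi t = Psi_nonneg \<bar>t\<bar>"

definition screw_g :: "real \<Rightarrow> complex" where
  "screw_g t = complex_of_real (- Psi t)"

definition screw_kernel :: "(real \<Rightarrow> complex) \<Rightarrow> real \<Rightarrow> real \<Rightarrow> complex" where
  "screw_kernel h t u = h (t - u) - h t - h (- u) + h 0"

text \<open>The class of functions on \<open>(-2a, 2a)\<close> for \<open>0 < a \<le> \<infinity>\<close>. A function on this interval is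
  represented by a total function; its values outside the interval are not constrained. The
  order on \<^typ>\<open>complex\<close> is the one in which \<open>0 \<le> z\<close> says that \<open>z\<close> is real and nonnegative.\<close>

definition screw_class :: "ereal \<Rightarrow> (real \<Rightarrow> complex) set" where
  "screw_class a = {h.
     continuous_on {t. ereal \<bar>t\<bar> < 2 * a} h \<and>
     (\<forall>t. ereal \<bar>t\<bar> < 2 * a \<longrightarrow> h (- t) = cnj (h t)) \<and>
     (\<forall>(n::nat) (t :: nat \<Rightarrow> real) (\<xi> :: nat \<Rightarrow> complex).
        (\<forall>i\<in>{1..n}. ereal \<bar>t i\<bar> < a) \<longrightarrow>
        0 \<le> (\<Sum>i=1..n. \<Sum>j=1..n. screw_kernel h (t i) (t j) * \<xi> i * cnj (\<xi> j)))}"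

text \<open>Complex-valued square-integrable functions, as functions rather than as classes modulo
  almost everywhere equality: being a non-zero element of \<open>L\<^sup>2\<close> means not vanishing almost
  everywhere.\<close>

definition L2_on :: "real set \<Rightarrow> (real \<Rightarrow> complex) set" where
  "L2_on S = {\<phi>. \<phi> \<in> borel_measurable (lebesgue_on S) \<and>
                 integrable (lebesgue_on S) (\<lambda>t. (cmod (\<phi> t))\<^sup>2)}"

definition pos_def_kernel_on :: "real set \<Rightarrow> (real \<Rightarrow> real \<Rightarrow> complex) \<Rightarrow> bool" where
  "pos_def_kernel_on S K \<longleftrightarrow>
     (\<forall>\<phi>\<in>L2_on S. \<not> (AE t in lebesgue_on S. \<phi> t = 0) \<longrightarrow>
        0 < (LINT t|lebesgue_on S. LINT u|lebesgue_on S. K t u * \<phi> u * cnj (\<phi> t)))"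

end

(*
  Near the origin g equals, up to an additive constant (which cancels in G_g),
    -4 (e^{t/2} + e^{-t/2}) + kappa |t| + sum_n e^{-l_n |t|} / l_n^2,   l_n = 2n + 1/2.
  Let b_t be the signed indicator of the interval between 0 and t. For C^2 functions L one has
  G_L(t,u) = - int int L''(x-y) b_t(x) b_u(y), while G_{|.|}(t,u) = -2 int b_t b_u. Since
  e^{-l|t|}/l^2 + |t|/l is C^2 with second derivative e^{-l|t|}, the form of the m-th partial sum,
  written in terms of F = int xi(w) b_{tau(w)} dw, is
    (2 sum_{n<m} 1/l_n - 2 kappa) int |F|^2 - int int k_m(x-y) F(y) conj F(x),
  with k_m the sum of the e^{-l_n|.|} and a bounded function. By Schur's test the double integral
  costs at most int |F|^2 times sup_x int_{-a}^a |k_m(x-y)| dy, to which the n-th exponential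
  contributes at most min(2a, 2/l_n). As sum 1/l_n diverges, finitely many n with a small leave a
  surplus of int |F|^2, uniformly in m. The integration over an arbitrary measure covers point masses
  (the class G_a) and Lebesgue measure; in the latter case F = 0 forces xi = 0 almost everywhere.
*)
theory Submission
  imports Defs
begin

subsection \<open>Signed step functions\<close>

text \<open>The sign encodes the orientation of the interval from 0 to \<open>t\<close>, so that
  integrating a derivative against \<open>step t\<close> gives an increment from 0 for either sign
  of \<open>t\<close>. Closing the intervals matters at their endpoints only, hence for no Lebesgue
  integral in \<open>x\<close>.\<close>

definition step :: "real \<Rightarrow> real \<Rightarrow> real" where
  "step t x = (if 0 \<le> t then indicator {0..t} x else - indicator {t..0} x)"

lemma step_measurable [measurable]:
  "(\<lambda>(t, x). step t x) \<in> borel_measurable (borel \<Otimes>\<^sub>M borel)"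
  unfolding step_def indicator_def atLeastAtMost_iff split_beta' by measurable

lemma step_measurable' [measurable]:
  assumes [measurable]: "f \<in> borel_measurable M" "g \<in> borel_measurable M"
  shows "(\<lambda>x. step (f x) (g x)) \<in> borel_measurable M"
  using measurable_compose[of "\<lambda>x. (f x, g x)" M "borel \<Otimes>\<^sub>M borel" "\<lambda>(t, x). step t x" borel]
  by simp

lemma abs_step_le_1: "\<bar>step t x\<bar> \<le> 1"
  by (auto simp: step_def indicator_def)

lemma integral_step_mult:
  fixes F f :: "real \<Rightarrow> real"
  assumes F: "\<And>x. (F has_real_derivative f x) (at x)" and f: "\<And>x. isCont f x"
    and t: "\<bar>t\<bar> \<le> a"
  shows "(LINT x|restrict_space lborel {-a..a}. step t x * f x) = F t - F 0"
proof -
  have "(LINT x|restrict_space lborel {-a..a}. step t x * f x)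
      = (LINT x|lborel. indicator {-a..a} x *\<^sub>R (step t x * f x))"
    by (rule integral_restrict_space) auto
  also have "\<dots> = F t - F 0"
  proof (cases "0 \<le> t")
    case True
    have "(LINT x|lborel. indicator {-a..a} x *\<^sub>R (step t x * f x))
        = (LINT x|lborel. f x * indicator {0..t} x)"
      by (rule Bochner_Integration.integral_cong) (use True t in \<open>auto simp: step_def indicator_def\<close>)
    also have "\<dots> = F t - F 0"
      by (rule integral_FTC_Icc_real) (use True F f in auto)
    finally show ?thesis .
  next
    case False
    have "(LINT x|lborel. indicator {-a..a} x *\<^sub>R (step t x * f x))
        = (LINT x|lborel. - (f x * indicator {t..0} x))"
      by (rule Bochner_Integration.integral_cong) (use False t in \<open>auto simp: step_def indicator_def\<close>)
    also have "\<dots> = - (LINT x|lborel. f x * indicator {t..0} x)" by simp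
    also have "(LINT x|lborel. f x * indicator {t..0} x) = F 0 - F t"
      by (rule integral_FTC_Icc_real) (use False F f in auto)
    finally show ?thesis by simp
  qed
  finally show ?thesis .
qed

text \<open>Steps of equal sign overlap in an interval of length min(|t|, |u|), which is half of the
  right-hand side; for opposite signs both sides vanish. Through this identity the corner of the
  absolute value becomes an L2 product.\<close>

lemma integral_step_step:
  assumes "\<bar>t\<bar> \<le> a" "\<bar>u\<bar> \<le> a"
  shows "2 * (LINT x|restrict_space lborel {-a..a}. step t x * step u x) = \<bar>t\<bar> + \<bar>u\<bar> - \<bar>t - u\<bar>"
proof -
  have "(LINT x|restrict_space lborel {-a..a}. step t x * step u x)
      = (LINT x|lborel. indicator {-a..a} x *\<^sub>R (step t x * step u x))"
    by (rule integral_restrict_space) auto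
  also consider "0 \<le> t" "0 \<le> u" | "t < 0" "u < 0" | "t < 0 \<and> 0 \<le> u \<or> 0 \<le> t \<and> u < 0" by linarith
  then have "(LINT x|lborel. indicator {-a..a} x *\<^sub>R (step t x * step u x)) = (\<bar>t\<bar> + \<bar>u\<bar> - \<bar>t - u\<bar>) / 2"
  proof cases
    case 1
    have "(LINT x|lborel. indicator {-a..a} x *\<^sub>R (step t x * step u x)) = (LINT x|lborel. indicator {0..min t u} x)"
      by (rule Bochner_Integration.integral_cong) (use 1 assms in \<open>auto simp: step_def indicator_def\<close>)
    then show ?thesis using 1 by (auto simp: min_def)
  next
    case 2
    have "(LINT x|lborel. indicator {-a..a} x *\<^sub>R (step t x * step u x)) = (LINT x|lborel. indicator {max t u..0} x)"
      by (rule Bochner_Integration.integral_cong) (use 2 assms in \<open>auto simp: step_def indicator_def\<close>)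
    then show ?thesis using 2 by (auto simp: max_def)
  next
    case 3
    \<comment> \<open>The two closed intervals may share the point 0, so the product vanishes only
      almost everywhere.\<close>
    have "AE x in lborel. x \<noteq> (0::real)" by (rule AE_lborel_singleton)
    then have "AE x in lborel. indicator {-a..a} x *\<^sub>R (step t x * step u x) = 0"
      by eventually_elim (use 3 in \<open>auto simp: step_def indicator_def\<close>)
    then show ?thesis using 3 by (auto simp: integral_eq_zero_AE)
  qed
  finally show ?thesis by simp
qed

definition real_screw_kernel :: "(real \<Rightarrow> real) \<Rightarrow> real \<Rightarrow> real \<Rightarrow> real" where
  "real_screw_kernel h t u = h (t - u) - h t - h (- u) + h 0"

text \<open>The fundamental theorem of calculus, once in each variable: \<open>H (x - y)\<close> is
  an antiderivative of \<open>k (x - y)\<close> in \<open>x\<close>, and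
  \<open>L (- y) - L (t - y)\<close> is one in \<open>y\<close> of the result. Its increment from 0
  to \<open>u\<close> is minus the kernel of \<open>L\<close>.\<close>

lemma real_screw_kernel_eq_integral:
  fixes L H k :: "real \<Rightarrow> real"
  assumes L: "\<And>x. (L has_real_derivative H x) (at x)"
    and H: "\<And>x. (H has_real_derivative k x) (at x)" and k: "\<And>x. isCont k x"
    and t: "\<bar>t\<bar> \<le> a" and u: "\<bar>u\<bar> \<le> a"
  defines "N \<equiv> restrict_space lborel {-a..a}"
  shows "real_screw_kernel (\<lambda>x. L x + \<gamma> * \<bar>x\<bar>) t u =
    - (2 * \<gamma> * (LINT x|N. step t x * step u x)) - (LINT y|N. step u y * (LINT x|N. step t x * k (x - y)))"
proof -
  have inner: "(LINT x|N. step t x * k (x - y)) = H (t - y) - H (- y)" for y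
  proof -
    have "((\<lambda>x. H (x - y)) has_real_derivative k (x - y)) (at x)" for x
      by (rule DERIV_cong[OF DERIV_chain2[where g="\<lambda>x. x - y" and f=H, OF H]])
        (auto intro!: derivative_eq_intros)
    moreover have "isCont (\<lambda>x. k (x - y)) x" for x
      by (rule isCont_o2[OF _ k]) simp
    ultimately show ?thesis
      using integral_step_mult[OF _ _ t, where F="\<lambda>x. H (x - y)"] unfolding N_def by simp
  qed
  have outer: "(LINT y|N. step u y * (H (t - y) - H (- y))) = (L (-u) - L (t - u)) - (L 0 - L t)"
  proof -
    have "((\<lambda>y. L (s - y)) has_real_derivative - H (s - y)) (at y)" for s y
      by (rule DERIV_cong[OF DERIV_chain2[where g="\<lambda>y. s - y" and f=L, OF L]])
        (auto intro!: derivative_eq_intros)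
    from DERIV_diff[OF this[of 0] this[of t]]
    have "((\<lambda>y. L (- y) - L (t - y)) has_real_derivative H (t - y) - H (- y)) (at y)" for y
      by simp
    moreover have "isCont H x" for x using DERIV_isCont[OF H] .
    then have "isCont (\<lambda>y. H (s - y)) x" for s x
      by (rule isCont_o2[rotated]) simp
    from continuous_diff[OF this[where s=t] this[where s=0]]
    have "isCont (\<lambda>y. H (t - y) - H (- y)) x" for x by simp
    ultimately show ?thesis
      using integral_step_mult[OF _ _ u, where F="\<lambda>y. L (- y) - L (t - y)"] unfolding N_def by simp
  qed
  have "2 * (LINT x|N. step t x * step u x) = \<bar>t\<bar> + \<bar>u\<bar> - \<bar>t - u\<bar>"
    unfolding N_def by (rule integral_step_step[OF t u])
  then have diag: "2 * \<gamma> * (LINT x|N. step t x * step u x) = \<gamma> * (\<bar>t\<bar> + \<bar>u\<bar> - \<bar>t - u\<bar>)"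
    by (metis mult.assoc mult.left_commute)
  show ?thesis
    unfolding inner outer diag real_screw_kernel_def by (simp add: algebra_simps)
qed

subsection \<open>The quadratic form of a difference kernel\<close>

lemma norm_integral_le:
  fixes f :: "'a \<Rightarrow> 'b::{banach, second_countable_topology}"
  assumes "integrable M f" "integrable M g" "\<And>x. x \<in> space M \<Longrightarrow> norm (f x) \<le> g x"
  shows "norm (integral\<^sup>L M f) \<le> integral\<^sup>L M g"
  using assms by (intro order_trans[OF integral_norm_bound integral_mono]) auto

lemma borel_measurable_cnj [measurable (raw)]:
  "f \<in> borel_measurable M \<Longrightarrow> (\<lambda>x. cnj (f x)) \<in> borel_measurable M"
  by (rule borel_measurable_continuous_on[of cnj]) (auto intro: continuous_intros)

text \<open>The majorant \<open>B * cmod (\<xi> \<omega>)\<close> is integrable over the product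
  because \<open>N\<close> has finite mass. This provides the hypothesis of Fubini's
  theorem.\<close>

lemma integrable_bounded_times_pair:
  fixes \<xi> :: "'a \<Rightarrow> complex" and v :: "'a \<times> 'b \<Rightarrow> complex"
  assumes M: "sigma_finite_measure M" and N: "finite_measure N"
    and \<xi>: "integrable M \<xi>" and v [measurable]: "v \<in> borel_measurable (M \<Otimes>\<^sub>M N)"
    and B: "\<And>z. z \<in> space (M \<Otimes>\<^sub>M N) \<Longrightarrow> cmod (v z) \<le> B"
  shows "integrable (M \<Otimes>\<^sub>M N) (\<lambda>(\<omega>, x). \<xi> \<omega> * v (\<omega>, x))"
proof -
  interpret M: sigma_finite_measure M by fact
  interpret N: finite_measure N by fact
  interpret MN: pair_sigma_finite M N ..
  have [measurable]: "\<xi> \<in> borel_measurable M" using \<xi> by auto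
  have "integrable (M \<Otimes>\<^sub>M N) (\<lambda>(\<omega>, x). B * cmod (\<xi> \<omega>))"
  proof (rule MN.Fubini_integrable)
    show "integrable M (\<lambda>\<omega>. LINT x|N. norm (case (\<omega>, x) of (\<omega>, x) \<Rightarrow> B * cmod (\<xi> \<omega>)))"
      using \<xi> by (auto intro!: integrable_mult_right simp: abs_mult)
  qed auto
  then show ?thesis
  proof (rule Bochner_Integration.integrable_bound)
    show "AE z in M \<Otimes>\<^sub>M N. norm (case z of (\<omega>, x) \<Rightarrow> \<xi> \<omega> * v (\<omega>, x))
        \<le> norm (case z of (\<omega>, x) \<Rightarrow> B * cmod (\<xi> \<omega>))"
    proof (rule AE_I2)
      fix z assume "z \<in> space (M \<Otimes>\<^sub>M N)"
      from B[OF this] have "cmod (v z) \<le> \<bar>B\<bar>" by linarith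
      then show "norm (case z of (\<omega>, x) \<Rightarrow> \<xi> \<omega> * v (\<omega>, x))
        \<le> norm (case z of (\<omega>, x) \<Rightarrow> B * cmod (\<xi> \<omega>))"
        by (cases z) (simp add: norm_mult abs_mult mult.commute[of "\<bar>B\<bar>"] mult_left_mono)
    qed
  qed measurable
qed

lemma borel_measurable_restrict_lborel [measurable (raw)]:
  "f \<in> borel_measurable borel \<Longrightarrow> f \<in> borel_measurable (restrict_space lborel S)"
  by (rule measurable_restrict_space1) simp

lemma finite_measure_interval: "finite_measure (restrict_space lborel {a..b::real})"
  by (rule finite_measureI)
    (simp add: emeasure_restrict_space space_restrict_space emeasure_lborel_Icc_eq)

text \<open>Fubini trades the weight \<open>\<xi>\<close> on an arbitrary space for its step
  transform on the interval. It is applied once for each of the two arguments of the screw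
  kernel.\<close>

lemma integral_step_pairing:
  fixes \<xi> :: "'a \<Rightarrow> complex" and v :: "real \<Rightarrow> complex" and a :: real
  defines "N \<equiv> restrict_space lborel {-a..a}"
  assumes M: "sigma_finite_measure M" and [measurable]: "\<tau> \<in> borel_measurable M"
    and \<xi>: "integrable M \<xi>" and v [measurable]: "v \<in> borel_measurable N"
    and B: "\<And>x. x \<in> {-a..a} \<Longrightarrow> cmod (v x) \<le> B"
  shows "(LINT \<omega>|M. \<xi> \<omega> * (LINT x|N. of_real (step (\<tau> \<omega>) x) * v x))
    = (LINT x|N. (LINT \<omega>|M. \<xi> \<omega> * of_real (step (\<tau> \<omega>) x)) * v x)"
proof -
  interpret M: sigma_finite_measure M by fact
  interpret N: finite_measure N unfolding N_def by (rule finite_measure_interval)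
  interpret MN: pair_sigma_finite M N ..
  have [measurable]: "\<xi> \<in> borel_measurable M" using \<xi> by auto
  have [measurable]: "(\<lambda>x. x) \<in> borel_measurable N" unfolding N_def by measurable
  have "integrable (M \<Otimes>\<^sub>M N) (\<lambda>(\<omega>, x). \<xi> \<omega> * (\<lambda>(\<omega>, x). of_real (step (\<tau> \<omega>) x) * v x) (\<omega>, x))"
  proof (rule integrable_bounded_times_pair[OF M N.finite_measure_axioms \<xi>])
    fix z assume "z \<in> space (M \<Otimes>\<^sub>M N)"
    then have "cmod (v (snd z)) \<le> B" by (auto simp: N_def space_pair_measure space_restrict_space intro!: B)
    moreover have "\<bar>step (\<tau> (fst z)) (snd z)\<bar> * cmod (v (snd z)) \<le> 1 * cmod (v (snd z))"
      by (intro mult_right_mono abs_step_le_1) auto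
    ultimately show "cmod (case z of (\<omega>, x) \<Rightarrow> of_real (step (\<tau> \<omega>) x) * v x) \<le> B"
      by (auto simp: split_beta norm_mult)
  qed measurable
  then have *: "integrable (M \<Otimes>\<^sub>M N) (case_prod (\<lambda>\<omega> x. \<xi> \<omega> * (of_real (step (\<tau> \<omega>) x) * v x)))"
    by (simp add: split_beta)
  have "(LINT \<omega>|M. \<xi> \<omega> * (LINT x|N. of_real (step (\<tau> \<omega>) x) * v x))
      = (LINT \<omega>|M. LINT x|N. \<xi> \<omega> * (of_real (step (\<tau> \<omega>) x) * v x))"
    by simp
  also have "\<dots> = (LINT x|N. LINT \<omega>|M. \<xi> \<omega> * (of_real (step (\<tau> \<omega>) x) * v x))"
    by (rule MN.Fubini_integral[OF *, symmetric])
  also have "\<dots> = (LINT x|N. (LINT \<omega>|M. \<xi> \<omega> * of_real (step (\<tau> \<omega>) x)) * v x)"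
    by (simp flip: mult.assoc)
  finally show ?thesis .
qed

lemma cmod_step_transform_le:
  fixes \<xi> :: "'a \<Rightarrow> complex"
  assumes \<xi>: "integrable M \<xi>" and [measurable]: "\<tau> \<in> borel_measurable M"
  shows "cmod (LINT \<omega>|M. \<xi> \<omega> * of_real (step (\<tau> \<omega>) x)) \<le> (LINT \<omega>|M. cmod (\<xi> \<omega>))"
proof -
  have "norm (\<xi> \<omega> * of_real (step (\<tau> \<omega>) x)) \<le> norm (\<xi> \<omega>)" for \<omega>
    using mult_left_mono[OF abs_step_le_1, of "cmod (\<xi> \<omega>)" "\<tau> \<omega>" x] by (simp add: norm_mult)
  moreover have [measurable]: "\<xi> \<in> borel_measurable M" using \<xi> by auto
  ultimately show ?thesis
    using \<xi> by (intro norm_integral_le Bochner_Integration.integrable_bound[OF \<xi>]) auto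
qed

section \<open>Schur's test for a difference kernel on an interval\<close>

text \<open>The density \<open>k\<close> to be used contains exponentials that grow at infinity, so
  a bound is asked only on differences of points of the interval.\<close>

locale difference_kernel =
  fixes a K :: real and k :: "real \<Rightarrow> real"
  assumes isCont_k: "isCont k x" and k_bound: "\<bar>z\<bar> \<le> 2 * a \<Longrightarrow> \<bar>k z\<bar> \<le> K"
begin

definition N :: "real measure" where "N = restrict_space lborel {-a..a}"

sublocale N: finite_measure N
  unfolding N_def by (rule finite_measure_interval)

sublocale NN: pair_sigma_finite N N ..

lemma space_N: "space N = {-a..a}"
  by (simp add: N_def space_restrict_space)

lemma k_measurable [measurable]: "k \<in> borel_measurable borel"
  using isCont_k by (intro borel_measurable_continuous_onI continuous_at_imp_continuous_on) auto

lemma measurable_id_N [measurable]: "(\<lambda>x. x) \<in> borel_measurable N"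
  unfolding N_def by measurable

lemma measurable_fst_snd_N [measurable]:
  "fst \<in> borel_measurable (N \<Otimes>\<^sub>M M)" "snd \<in> borel_measurable (M \<Otimes>\<^sub>M N)"
  using measurable_compose[OF measurable_fst measurable_id_N] measurable_compose[OF measurable_snd measurable_id_N]
  by auto

lemma integrable_N:
  fixes f :: "real \<Rightarrow> 'b::{banach, second_countable_topology}"
  assumes "f \<in> borel_measurable N" "\<And>x. x \<in> {-a..a} \<Longrightarrow> norm (f x) \<le> B"
  shows "integrable N f"
  using assms by (intro N.integrable_const_bound[of _ B]) (auto simp: space_N)

lemma integrable_NN:
  fixes f :: "real \<Rightarrow> real \<Rightarrow> 'b::{banach, second_countable_topology}"
  assumes "case_prod f \<in> borel_measurable (N \<Otimes>\<^sub>M N)"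
    and "\<And>x y. x \<in> {-a..a} \<Longrightarrow> y \<in> {-a..a} \<Longrightarrow> norm (f x y) \<le> B"
  shows "integrable (N \<Otimes>\<^sub>M N) (case_prod f)"
proof -
  interpret P: finite_measure "N \<Otimes>\<^sub>M N"
    by (rule finite_measure_pair_measure) unfold_locales
  show ?thesis
    using assms by (intro P.integrable_const_bound[of _ B]) (auto simp: space_N space_pair_measure)
qed

definition conv :: "(real \<Rightarrow> complex) \<Rightarrow> real \<Rightarrow> complex" where
  "conv F x = (LINT y|N. of_real (k (x - y)) * F y)"

context
  fixes F :: "real \<Rightarrow> complex" and A :: real
  assumes F [measurable]: "F \<in> borel_measurable N"
    and A: "\<And>x. x \<in> {-a..a} \<Longrightarrow> cmod (F x) \<le> A"
begin

lemma conv_measurable [measurable]: "conv F \<in> borel_measurable N"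
  unfolding conv_def by measurable

lemma k_diff_bound:
  assumes "x \<in> {-a..a}" "y \<in> {-a..a}"
  shows "\<bar>k (x - y)\<bar> \<le> K"
  using assms by (intro k_bound) auto

lemma k_F_bound:
  assumes "x \<in> {-a..a}" "y \<in> {-a..a}"
  shows "cmod (of_real (k (x - y)) * F y) \<le> K * A"
  using k_diff_bound[OF assms] A[OF assms(2)] by (auto simp: norm_mult intro!: mult_mono)

lemma conv_bound:
  assumes "x \<in> {-a..a}"
  shows "cmod (conv F x) \<le> K * A * measure N (space N)"
proof -
  have "cmod (conv F x) \<le> (LINT y|N. K * A)"
    unfolding conv_def
  proof (rule norm_integral_le)
    show "integrable N (\<lambda>y. of_real (k (x - y)) * F y)"
      by (rule integrable_N[OF _ k_F_bound[OF assms]]) measurable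
  qed (use k_F_bound[OF assms] in \<open>auto simp: space_N\<close>)
  then show ?thesis by (simp add: mult_ac)
qed

lemma conv_form_eq:
  "(LINT x|N. cnj (F x) * conv F x) = (LINT x|N. LINT y|N. of_real (k (x - y)) * cnj (F x) * F y)"
  unfolding conv_def by (simp add: mult_ac flip: integral_mult_right_zero)

lemma form_bound:
  assumes "x \<in> {-a..a}" "y \<in> {-a..a}"
  shows "cmod (of_real (k (x - y)) * cnj (F x) * F y) \<le> K * A * A"
proof -
  have "0 \<le> K" "0 \<le> A"
    using k_diff_bound[OF assms] A[OF assms(1)] abs_ge_zero norm_ge_zero by (meson order_trans)+
  then show ?thesis
    using k_diff_bound[OF assms] A[OF assms(1)] A[OF assms(2)]
    by (auto simp: norm_mult intro!: mult_mono)
qed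

lemma integrable_form:
  "integrable (N \<Otimes>\<^sub>M N) (\<lambda>(x, y). of_real (k (x - y)) * cnj (F x) * F y)"
  by (rule integrable_NN[OF _ form_bound]) measurable

text \<open>For a real even \<open>k\<close> conjugation exchanges the roles of \<open>x\<close> and
  \<open>y\<close>, and Fubini exchanges them back, so the form equals its own conjugate.\<close>

lemma Im_conv_form:
  assumes even: "\<And>z. k (- z) = k z"
  shows "Im (LINT x|N. cnj (F x) * conv F x) = 0"
proof -
  let ?T = "LINT x|N. LINT y|N. of_real (k (x - y)) * cnj (F x) * F y"
  have "cnj ?T = (LINT x|N. LINT y|N. of_real (k (x - y)) * F x * cnj (F y))"
    by (simp flip: Bochner_Integration.integral_cnj)
  also have "\<dots> = (LINT x|N. LINT y|N. of_real (k (y - x)) * cnj (F y) * F x)"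
    using even[of "y - x" for x y] by (simp add: mult_ac)
  also have "\<dots> = ?T"
    by (rule NN.Fubini_integral[OF integrable_form])
  finally show ?thesis
    by (simp add: conv_form_eq complex_eq_iff)
qed

text \<open>Schur's test by the inequality 2|F(x)||F(y)| \<le> |F(x)|^2 + |F(y)|^2. Renaming
  variables makes the two halves equal, and in each of them the inner integral of |k| is at most
  \<open>S\<close>.\<close>

lemma Re_conv_form_le:
  assumes even: "\<And>z. k (- z) = k z"
    and S: "\<And>x. x \<in> {-a..a} \<Longrightarrow> (LINT y|N. \<bar>k (x - y)\<bar>) \<le> S"
  shows "Re (LINT x|N. cnj (F x) * conv F x) \<le> S * (LINT x|N. (cmod (F x))\<^sup>2)"
proof -
  let ?h = "\<lambda>x y. \<bar>k (x - y)\<bar> * (cmod (F x))\<^sup>2"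
  have hb: "norm (?h x y) \<le> K * A\<^sup>2" if "x \<in> {-a..a}" "y \<in> {-a..a}" for x y
    using k_diff_bound[OF that] A[OF that(1)] by (auto simp: abs_mult intro!: mult_mono power_mono)
  have int_h: "integrable (N \<Otimes>\<^sub>M N) (\<lambda>(x, y). ?h x y)"
    by (rule integrable_NN[OF _ hb]) measurable
  have int_h': "integrable (N \<Otimes>\<^sub>M N) (\<lambda>(x, y). ?h y x)"
    using NN.integrable_product_swap[OF int_h] by (simp add: split_beta)
  have int_F: "integrable N (\<lambda>x. (cmod (F x))\<^sup>2)"
    by (rule integrable_N[of _ "A\<^sup>2"]) (auto intro!: power_mono A)
  have swap: "(LINT z|(N \<Otimes>\<^sub>M N). (case z of (x, y) \<Rightarrow> ?h y x)) = (LINT z|(N \<Otimes>\<^sub>M N). (case z of (x, y) \<Rightarrow> ?h x y))"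
    unfolding NN.integral_fst'[OF int_h', symmetric] NN.integral_fst'[OF int_h, symmetric]
    using NN.Fubini_integral[OF int_h] by simp
  have "Re (LINT x|N. cnj (F x) * conv F x) \<le> cmod (LINT z|(N \<Otimes>\<^sub>M N). (case z of (x, y) \<Rightarrow> of_real (k (x - y)) * cnj (F x) * F y))"
    unfolding conv_form_eq using NN.integral_fst'[OF integrable_form] by (simp add: complex_Re_le_cmod)
  also have "\<dots> \<le> (LINT z|(N \<Otimes>\<^sub>M N). (case z of (x, y) \<Rightarrow> (?h x y + ?h y x) / 2))"
  proof (rule norm_integral_le[OF integrable_form])
    show "integrable (N \<Otimes>\<^sub>M N) (\<lambda>(x, y). (?h x y + ?h y x) / 2)"
      using Bochner_Integration.integrable_add[OF int_h int_h'] by (simp add: case_prod_unfold)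
    fix z assume "z \<in> space (N \<Otimes>\<^sub>M N)"
    have "cmod (of_real (k (x - y)) * cnj (F x) * F y) \<le> (?h x y + ?h y x) / 2" for x y
    proof -
      have "\<bar>k (x - y)\<bar> * (2 * cmod (F x) * cmod (F y)) \<le> \<bar>k (x - y)\<bar> * ((cmod (F x))\<^sup>2 + (cmod (F y))\<^sup>2)"
        by (intro mult_left_mono sum_squares_bound) auto
      moreover have "k (y - x) = k (x - y)" using even[of "x - y"] by simp
      ultimately show ?thesis by (simp add: norm_mult algebra_simps)
    qed
    then show "norm (case z of (x, y) \<Rightarrow> of_real (k (x - y)) * cnj (F x) * F y)
        \<le> (case z of (x, y) \<Rightarrow> (?h x y + ?h y x) / 2)"
      by (cases z) simp
  qed
  also have "\<dots> = (LINT z|(N \<Otimes>\<^sub>M N). (case z of (x, y) \<Rightarrow> ?h x y))"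
  proof -
    have "(LINT z|(N \<Otimes>\<^sub>M N). (case z of (x, y) \<Rightarrow> (?h x y + ?h y x) / 2))
      = ((LINT z|(N \<Otimes>\<^sub>M N). (case z of (x, y) \<Rightarrow> ?h x y)) + (LINT z|(N \<Otimes>\<^sub>M N). (case z of (x, y) \<Rightarrow> ?h y x))) / 2"
      using Bochner_Integration.integral_add[OF int_h int_h'] by (simp add: case_prod_unfold)
    then show ?thesis unfolding swap by simp
  qed
  also have "\<dots> = (LINT x|N. (LINT y|N. \<bar>k (x - y)\<bar>) * (cmod (F x))\<^sup>2)"
    using NN.integral_fst'[OF int_h] by simp
  also have "\<dots> \<le> (LINT x|N. S * (cmod (F x))\<^sup>2)"
  proof (rule integral_mono)
    show "integrable N (\<lambda>x. (LINT y|N. \<bar>k (x - y)\<bar>) * (cmod (F x))\<^sup>2)"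
      using NN.integrable_fst'[OF int_h] by simp
    show "integrable N (\<lambda>x. S * (cmod (F x))\<^sup>2)"
      using int_F by simp
    fix x assume "x \<in> space N"
    then show "(LINT y|N. \<bar>k (x - y)\<bar>) * (cmod (F x))\<^sup>2 \<le> S * (cmod (F x))\<^sup>2"
      by (intro mult_right_mono S) (auto simp: space_N)
  qed
  also have "\<dots> = S * (LINT x|N. (cmod (F x))\<^sup>2)" by simp
  finally show ?thesis .
qed

end

end

section \<open>The screw form in terms of the step transform\<close>

context difference_kernel
begin

text \<open>The integral representation of the kernel is linear in
  \<open>step (\<tau> \<omega>)\<close> and in \<open>step (\<tau> \<omega>')\<close>. Integrating
  against the weights turns the second into \<open>F\<close> and the first into the conjugate of
  \<open>F\<close>; the corner yields the diagonal term and the smooth part the convolution.\<close>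

lemma screw_form_eq:
  fixes \<xi> :: "'a \<Rightarrow> complex" and L H :: "real \<Rightarrow> real"
  assumes L: "\<And>x. (L has_real_derivative H x) (at x)"
    and H: "\<And>x. (H has_real_derivative k x) (at x)"
    and M: "sigma_finite_measure M" and \<tau> [measurable]: "\<tau> \<in> borel_measurable M"
    and \<tau>_le: "\<And>\<omega>. \<omega> \<in> space M \<Longrightarrow> \<bar>\<tau> \<omega>\<bar> \<le> a" and \<xi>: "integrable M \<xi>"
  defines "F \<equiv> \<lambda>x. LINT \<omega>|M. \<xi> \<omega> * of_real (step (\<tau> \<omega>) x)"
  shows "(LINT \<omega>|M. LINT \<omega>'|M.
      of_real (real_screw_kernel (\<lambda>x. L x + \<gamma> * \<bar>x\<bar>) (\<tau> \<omega>) (\<tau> \<omega>')) * \<xi> \<omega>' * cnj (\<xi> \<omega>))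
    = of_real (- 2 * \<gamma> * (LINT x|N. (cmod (F x))\<^sup>2)) - (LINT x|N. cnj (F x) * conv F x)"
proof -
  define A where "A = (LINT \<omega>|M. cmod (\<xi> \<omega>))"
  define g where "g = real_screw_kernel (\<lambda>x. L x + \<gamma> * \<bar>x\<bar>)"
  \<comment> \<open>\<open>w\<close> is the operator "-2 \<open>\<gamma>\<close> minus convolution
    with \<open>k\<close>" applied to \<open>F\<close>, so that the whole form is the inner product
    of \<open>w\<close> with \<open>F\<close>.\<close>
  define w where "w = (\<lambda>x. of_real (- 2 * \<gamma>) * F x - conv F x)"
  interpret M: sigma_finite_measure M by fact
  have \<xi>_meas [measurable]: "\<xi> \<in> borel_measurable M" using \<xi> by auto
  have FA: "cmod (F x) \<le> A" for x
    unfolding F_def A_def by (rule cmod_step_transform_le[OF \<xi> \<tau>])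
  have F_meas [measurable]: "F \<in> borel_measurable N"
    unfolding F_def by measurable
  note conv_measurable[OF F_meas FA, measurable]
  have w_meas [measurable]: "w \<in> borel_measurable N" unfolding w_def by measurable
  have wB: "cmod (w x) \<le> \<bar>2 * \<gamma>\<bar> * A + K * A * measure N (space N)" if "x \<in> {-a..a}" for x
  proof -
    have "cmod (w x) \<le> cmod (of_real (- 2 * \<gamma>) * F x) + cmod (conv F x)"
      unfolding w_def by (rule norm_triangle_ineq4)
    also have "cmod (of_real (- 2 * \<gamma>) * F x) \<le> \<bar>2 * \<gamma>\<bar> * A"
      unfolding norm_mult norm_of_real by (intro mult_mono FA) auto
    also have "cmod (conv F x) \<le> K * A * measure N (space N)"
      by (rule conv_bound[OF F_meas FA that])
    finally show ?thesis by simp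
  qed
  have stepk_bound: "norm (step t x * k (x - y)) \<le> K" if "x \<in> {-a..a}" "y \<in> {-a..a}" for t x y
  proof -
    have "\<bar>step t x\<bar> * \<bar>k (x - y)\<bar> \<le> 1 * K"
      using that by (intro mult_mono abs_step_le_1 k_bound) auto
    then show ?thesis by (simp add: abs_mult)
  qed
  have inner: "(LINT \<omega>'|M. of_real (g t (\<tau> \<omega>')) * \<xi> \<omega>') = (LINT x|N. of_real (step t x) * w x)"
    if t: "\<bar>t\<bar> \<le> a" for t
  proof -
    \<comment> \<open>For fixed \<open>t\<close>, the function \<open>v\<close> represents the
      kernel as the pairing of \<open>step u\<close> with \<open>v\<close>; the variable
      \<open>x\<close> attached to \<open>t\<close> is already integrated out.\<close>
    define v where "v = (\<lambda>y. - 2 * \<gamma> * step t y - (LINT x|N. step t x * k (x - y)))"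
    have v_meas [measurable]: "v \<in> borel_measurable N" unfolding v_def by measurable
    have vk: "\<bar>LINT x|N. step t x * k (x - y)\<bar> \<le> K * measure N (space N)" if "y \<in> {-a..a}" for y
    proof -
      have "norm (LINT x|N. step t x * k (x - y)) \<le> (LINT x|N. K)"
      proof (rule norm_integral_le)
        show "integrable N (\<lambda>x. step t x * k (x - y))"
          by (rule integrable_N[OF _ stepk_bound[OF _ that]]) measurable
      qed (use stepk_bound[OF _ that] in \<open>auto simp: space_N\<close>)
      then show ?thesis by (simp add: mult_ac)
    qed
    have vB: "\<bar>v y\<bar> \<le> \<bar>2 * \<gamma>\<bar> + K * measure N (space N)" if "y \<in> {-a..a}" for y
    proof -
      have "\<bar>v y\<bar> \<le> \<bar>2 * \<gamma> * step t y\<bar> + \<bar>LINT x|N. step t x * k (x - y)\<bar>"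
        unfolding v_def by linarith
      also have "\<bar>2 * \<gamma> * step t y\<bar> \<le> \<bar>2 * \<gamma>\<bar> * 1"
        unfolding abs_mult[of "2 * \<gamma>"] by (intro mult_left_mono abs_step_le_1) auto
      finally show ?thesis using vk[OF that] by simp
    qed
    have int_sk: "integrable N (\<lambda>y. step u y * (LINT x|N. step t x * k (x - y)))" for u
    proof (rule integrable_N[where B="K * measure N (space N)"])
      fix y assume "y \<in> {-a..a}"
      from vk[OF this] abs_step_le_1[of u y]
      have "\<bar>step u y\<bar> * \<bar>LINT x|N. step t x * k (x - y)\<bar> \<le> 1 * (K * measure N (space N))"
        by (intro mult_mono) auto
      then show "norm (step u y * (LINT x|N. step t x * k (x - y))) \<le> K * measure N (space N)"
        by (simp add: abs_mult)
    qed measurable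
    have int_ss: "integrable N (\<lambda>y. step t y * step u y)" for u
      by (intro integrable_N[where B=1]) (auto simp: abs_mult intro!: mult_le_one abs_step_le_1)
    have int_sF: "integrable N (\<lambda>y. of_real (step t y) * F y)"
    proof (rule integrable_N[where B="1 * A"])
      show "norm (of_real (step t y) * F y) \<le> 1 * A" for y
        unfolding norm_mult norm_of_real by (intro mult_mono abs_step_le_1 FA) auto
    qed measurable
    have int_sC: "integrable N (\<lambda>y. of_real (step t y) * conv F y)"
    proof (rule integrable_N[where B="1 * (K * A * measure N (space N))"])
      show "norm (of_real (step t y) * conv F y) \<le> 1 * (K * A * measure N (space N))" if "y \<in> {-a..a}" for y
        unfolding norm_mult norm_of_real
        by (intro mult_mono abs_step_le_1 conv_bound[OF F_meas FA that]) auto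
    qed measurable
    have int_skF: "integrable (N \<Otimes>\<^sub>M N) (\<lambda>(y, x). of_real (step t x * k (x - y)) * F y)"
    proof (rule integrable_NN[where B="K * A"])
      fix y x assume xy: "y \<in> {-a..a}" "x \<in> {-a..a}"
      then have "0 \<le> K" using stepk_bound[OF xy(2,1)] norm_ge_zero order_trans by blast
      then show "norm (complex_of_real (step t x * k (x - y)) * F y) \<le> K * A"
        using stepk_bound[OF xy(2,1), of t] unfolding norm_mult norm_of_real real_norm_def
        by (intro mult_mono FA) auto
    qed measurable
    have g_eq: "g t u = (LINT y|N. step u y * v y)" if u: "\<bar>u\<bar> \<le> a" for u
    proof -
      have "(LINT y|N. step u y * v y)
          = (LINT y|N. (- 2 * \<gamma>) * (step t y * step u y) - step u y * (LINT x|N. step t x * k (x - y)))"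
        unfolding v_def by (simp add: algebra_simps)
      also have "\<dots> = (- 2 * \<gamma>) * (LINT y|N. step t y * step u y)
          - (LINT y|N. step u y * (LINT x|N. step t x * k (x - y)))"
        by (subst Bochner_Integration.integral_diff[OF integrable_mult_right[OF int_ss] int_sk]) simp
      finally show ?thesis
        unfolding g_def real_screw_kernel_eq_integral[OF L H isCont_k t u] N_def[symmetric] by simp
    qed
    have "(LINT \<omega>'|M. of_real (g t (\<tau> \<omega>')) * \<xi> \<omega>')
        = (LINT \<omega>'|M. \<xi> \<omega>' * (LINT y|N. of_real (step (\<tau> \<omega>') y) * of_real (v y)))"
    proof (rule Bochner_Integration.integral_cong[OF refl])
      fix \<omega>' assume "\<omega>' \<in> space M"
      then show "of_real (g t (\<tau> \<omega>')) * \<xi> \<omega>' = \<xi> \<omega>' * (LINT y|N. of_real (step (\<tau> \<omega>') y) * of_real (v y))"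
        using g_eq[OF \<tau>_le] by (simp add: mult.commute flip: of_real_mult)
    qed
    also have "\<dots> = (LINT y|N. F y * of_real (v y))"
      unfolding F_def N_def
      by (rule integral_step_pairing[OF M \<tau> \<xi>, where B="\<bar>2 * \<gamma>\<bar> + K * measure N (space N)"])
        (use vB in \<open>auto simp flip: N_def\<close>)
    also have "\<dots> = (LINT y|N. of_real (- 2 * \<gamma>) * (of_real (step t y) * F y)
        - (LINT x|N. of_real (step t x * k (x - y)) * F y))"
      unfolding v_def by (simp add: algebra_simps flip: integral_complex_of_real)
    also have "\<dots> = of_real (- 2 * \<gamma>) * (LINT y|N. of_real (step t y) * F y)
        - (LINT y|N. LINT x|N. of_real (step t x * k (x - y)) * F y)"
      using Bochner_Integration.integral_diff[OF integrable_mult_right[where c="of_real (- 2 * \<gamma>)", OF int_sF] NN.integrable_fst'[OF int_skF]] by simp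
    \<comment> \<open>After this exchange the integral over \<open>y\<close> is innermost and
      becomes \<open>conv F x\<close>.\<close>
    also have "(LINT y|N. LINT x|N. of_real (step t x * k (x - y)) * F y)
       = (LINT x|N. LINT y|N. of_real (step t x * k (x - y)) * F y)"
      by (rule NN.Fubini_integral[OF int_skF, symmetric])
    also have "of_real (- 2 * \<gamma>) * (LINT y|N. of_real (step t y) * F y) - \<dots> = (LINT x|N. of_real (step t x) * w x)"
      proof -
      have "(LINT x|N. LINT y|N. of_real (step t x * k (x - y)) * F y) = (LINT x|N. of_real (step t x) * conv F x)"
        unfolding conv_def by (simp add: mult.assoc)
      moreover have "(LINT x|N. of_real (step t x) * w x)
          = (LINT x|N. of_real (- 2 * \<gamma>) * (of_real (step t x) * F x) - of_real (step t x) * conv F x)"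
        unfolding w_def by (simp add: algebra_simps)
      ultimately show ?thesis
        using Bochner_Integration.integral_diff[OF integrable_mult_right[where c="of_real (- 2 * \<gamma>)", OF int_sF] int_sC] by simp
    qed
    finally show ?thesis .
  qed
  have "(LINT \<omega>|M. LINT \<omega>'|M. of_real (g (\<tau> \<omega>) (\<tau> \<omega>')) * \<xi> \<omega>' * cnj (\<xi> \<omega>))
      = (LINT \<omega>|M. cnj (\<xi> \<omega>) * (LINT x|N. of_real (step (\<tau> \<omega>) x) * w x))"
    by (rule Bochner_Integration.integral_cong[OF refl])
      (simp only: integral_mult_left_zero integral_mult_right_zero inner[OF \<tau>_le] mult.commute[of _ "cnj _"])
  \<comment> \<open>The second use of the pairing has the weight
    \<open>cnj (\<xi> \<omega>)\<close>; since steps are real, its transform is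
    \<open>cnj (F x)\<close>.\<close>
  also have "\<dots> = (LINT x|N. (LINT \<omega>|M. cnj (\<xi> \<omega>) * of_real (step (\<tau> \<omega>) x)) * w x)"
    unfolding N_def
    by (rule integral_step_pairing[OF M \<tau> _ _ wB]) (use \<xi> in \<open>auto simp flip: N_def\<close>)
  also have "\<dots> = (LINT x|N. cnj (F x) * w x)"
    unfolding F_def by (simp flip: Bochner_Integration.integral_cnj)
  also have "\<dots> = (LINT x|N. of_real (- 2 * \<gamma>) * of_real ((cmod (F x))\<^sup>2) - cnj (F x) * conv F x)"
    unfolding w_def by (simp add: algebra_simps complex_norm_square del: of_real_power)
  also have "\<dots> = of_real (- 2 * \<gamma>) * (LINT x|N. of_real ((cmod (F x))\<^sup>2)) - (LINT x|N. cnj (F x) * conv F x)"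
    proof -
    have "integrable N (\<lambda>x. complex_of_real ((cmod (F x))\<^sup>2))"
      by (intro integrable_of_real integrable_N[where B="A\<^sup>2"]) (auto intro!: power_mono FA)
    moreover have "integrable N (\<lambda>x. cnj (F x) * conv F x)"
      using conv_bound[OF F_meas FA] FA order_trans[OF norm_ge_zero FA]
      by (intro integrable_N[where B="A * (K * A * measure N (space N))"])
        (auto simp: norm_mult intro!: mult_mono)
    ultimately show ?thesis
      using Bochner_Integration.integral_diff[OF integrable_mult_right[where c="of_real (- 2 * \<gamma>)"]] by simp
  qed
  also have "\<dots> = of_real (- 2 * \<gamma> * (LINT x|N. (cmod (F x))\<^sup>2)) - (LINT x|N. cnj (F x) * conv F x)"
    by (simp add: integral_complex_of_real del: of_real_power)
  finally show ?thesis unfolding g_def .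
qed

text \<open>The diagonal term contributes -2 \<open>\<gamma>\<close> and Schur's test takes away at
  most \<open>S\<close>. The bound is useful when \<open>\<gamma>\<close> is sufficiently
  negative.\<close>

lemma screw_form_coercive:
  fixes \<xi> :: "'a \<Rightarrow> complex" and L H :: "real \<Rightarrow> real" and \<gamma> :: real
  assumes L: "\<And>x. (L has_real_derivative H x) (at x)"
    and H: "\<And>x. (H has_real_derivative k x) (at x)"
    and even: "\<And>z. k (- z) = k z"
    and S: "\<And>x. x \<in> {-a..a} \<Longrightarrow> (LINT y|N. \<bar>k (x - y)\<bar>) \<le> S"
    and M: "sigma_finite_measure M" and \<tau> [measurable]: "\<tau> \<in> borel_measurable M"
    and \<tau>_le: "\<And>\<omega>. \<omega> \<in> space M \<Longrightarrow> \<bar>\<tau> \<omega>\<bar> \<le> a" and \<xi>: "integrable M \<xi>"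
  defines "F \<equiv> \<lambda>x. LINT \<omega>|M. \<xi> \<omega> * of_real (step (\<tau> \<omega>) x)"
    and "Q \<equiv> LINT \<omega>|M. LINT \<omega>'|M.
      of_real (real_screw_kernel (\<lambda>x. L x + \<gamma> * \<bar>x\<bar>) (\<tau> \<omega>) (\<tau> \<omega>')) * \<xi> \<omega>' * cnj (\<xi> \<omega>)"
  shows "(- 2 * \<gamma> - S) * (LINT x|N. (cmod (F x))\<^sup>2) \<le> Re Q" and "Im Q = 0"
proof -
  interpret M: sigma_finite_measure M by fact
  have [measurable]: "\<xi> \<in> borel_measurable M" using \<xi> by auto
  have F: "F \<in> borel_measurable N" unfolding F_def by measurable
  have A: "cmod (F x) \<le> (LINT \<omega>|M. cmod (\<xi> \<omega>))" for x
    unfolding F_def by (rule cmod_step_transform_le[OF \<xi> \<tau>])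
  have Q: "Q = of_real (- 2 * \<gamma> * (LINT x|N. (cmod (F x))\<^sup>2)) - (LINT x|N. cnj (F x) * conv F x)"
    unfolding Q_def F_def by (rule screw_form_eq[OF L H M \<tau> \<tau>_le \<xi>])
  show "(- 2 * \<gamma> - S) * (LINT x|N. (cmod (F x))\<^sup>2) \<le> Re Q"
    using Re_conv_form_le[OF F A even S] unfolding Q by (simp add: algebra_simps)
  show "Im Q = 0"
    using Im_conv_form[OF F A even] unfolding Q by simp
qed

end

subsection \<open>Partial sums of the screw function\<close>

text \<open>Away from 0 only one branch is seen locally; at 0 the agreement of values and
  derivatives makes the two one-sided difference quotients converge to the same limit.\<close>

lemma DERIV_If_nonneg:
  fixes p q p' q' :: "real \<Rightarrow> real"
  assumes p: "\<And>z. (p has_real_derivative p' z) (at z)" and q: "\<And>z. (q has_real_derivative q' z) (at z)"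
    and eq: "p 0 = q 0" "p' 0 = q' 0"
  shows "((\<lambda>z. if 0 \<le> z then p z else q z) has_real_derivative (if 0 \<le> z then p' z else q' z)) (at z)"
    (is "(?f has_real_derivative _) _")
proof -
  consider "0 < z" | "z < 0" | "z = 0" by linarith
  then show ?thesis
  proof cases
    case 1
    have "(?f has_real_derivative p' z) (at z)"
      by (rule has_field_derivative_transform_within_open[OF p, where S="{0<..}"]) (use 1 in auto)
    then show ?thesis using 1 by simp
  next
    case 2
    have "(?f has_real_derivative q' z) (at z)"
      by (rule has_field_derivative_transform_within_open[OF q, where S="{..<0}"]) (use 2 in auto)
    then show ?thesis using 2 by simp
  next
    case 3
    have "(?f has_real_derivative p' 0) (at 0 within {0..})"
      by (rule has_field_derivative_transform_within[OF has_field_derivative_at_within[OF p], of 1]) auto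
    then have "(?f has_real_derivative p' 0) (at_right 0)"
      by (rule DERIV_subset) auto
    moreover have "(?f has_real_derivative q' 0) (at 0 within {..0})"
      by (rule has_field_derivative_transform_within[OF has_field_derivative_at_within[OF q], of 1]) (use eq in auto)
    then have "(?f has_real_derivative q' 0) (at_left 0)"
      by (rule DERIV_subset) auto
    ultimately have "(?f has_real_derivative p' 0) (at 0)"
      using eq unfolding has_field_derivative_iff by (auto intro: filterlim_split_at)
    then show ?thesis using 3 by simp
  qed
qed

text \<open>The antiderivative of \<open>exp (- l * \<bar>z\<bar>)\<close> that vanishes at
  0.\<close>

definition exp_abs_primitive :: "real \<Rightarrow> real \<Rightarrow> real" where
  "exp_abs_primitive l z = (if 0 \<le> z then (1 - exp (- l * z)) / l else (exp (l * z) - 1) / l)"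

lemma DERIV_exp_abs_primitive:
  assumes "0 < l"
  shows "(exp_abs_primitive l has_real_derivative exp (- l * \<bar>z\<bar>)) (at z)"
proof -
  have "((\<lambda>z. if 0 \<le> z then (1 - exp (- l * z)) / l else (exp (l * z) - 1) / l)
      has_real_derivative (if 0 \<le> z then exp (- l * z) else exp (l * z))) (at z)"
    by (rule DERIV_If_nonneg) (use assms in \<open>auto intro!: derivative_eq_intros simp: field_simps\<close>)
  moreover have "(if 0 \<le> z then exp (- l * z) else exp (l * z)) = exp (- l * \<bar>z\<bar>)"
    by auto
  ultimately show ?thesis
    by (simp add: exp_abs_primitive_def[abs_def])
qed

text \<open>Near 0 the exponential term has the corner -|z|/l, which the added |z|/l cancels; hence
  the two branches glue differentiably.\<close>

lemma DERIV_exp_abs_primitive2: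
  assumes "0 < l"
  shows "((\<lambda>z. exp (- l * \<bar>z\<bar>) / l\<^sup>2 + \<bar>z\<bar> / l) has_real_derivative exp_abs_primitive l z) (at z)"
proof -
  have "((\<lambda>z. if 0 \<le> z then exp (- l * z) / l\<^sup>2 + z / l else exp (l * z) / l\<^sup>2 - z / l)
      has_real_derivative (if 0 \<le> z then (1 - exp (- l * z)) / l else (exp (l * z) - 1) / l)) (at z)"
    by (rule DERIV_If_nonneg)
      (use assms in \<open>auto intro!: derivative_eq_intros simp: field_simps power2_eq_square\<close>)
  moreover have "(\<lambda>z. exp (- l * \<bar>z\<bar>) / l\<^sup>2 + \<bar>z\<bar> / l)
      = (\<lambda>z. if 0 \<le> z then exp (- l * z) / l\<^sup>2 + z / l else exp (l * z) / l\<^sup>2 - z / l)"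
    by auto
  ultimately show ?thesis
    by (simp add: exp_abs_primitive_def)
qed

lemma abs_exp_abs_primitive_le:
  assumes "0 < l"
  shows "\<bar>exp_abs_primitive l z\<bar> \<le> 1 / l"
  using assms by (auto simp: exp_abs_primitive_def divide_simps mult_le_0_iff)

text \<open>The first bound is a difference of two values of the primitive, each at most 1/l in
  modulus; the second bounds the integrand by 1. The first serves large rates, the second the
  finitely many remaining ones on a short interval.\<close>

lemma integral_exp_abs_le:
  fixes l a x :: real
  assumes "0 < l" "0 \<le> a"
  shows "(LINT y|restrict_space lborel {-a..a}. exp (- l * \<bar>x - y\<bar>)) \<le> 2 / l"
    and "(LINT y|restrict_space lborel {-a..a}. exp (- l * \<bar>x - y\<bar>)) \<le> 2 * a"
proof -
  let ?I = "LINT y|restrict_space lborel {-a..a}. exp (- l * \<bar>x - y\<bar>)"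
  have I: "?I = (LINT y|lborel. exp (- l * \<bar>x - y\<bar>) * indicator {-a..a} y)"
    by (subst integral_restrict_space) (simp_all add: mult.commute)
  also have "\<dots> = - exp_abs_primitive l (x - a) - - exp_abs_primitive l (x - (- a))"
  proof (rule integral_FTC_Icc_real)
    fix y
    have "((\<lambda>y. exp_abs_primitive l (x - y)) has_real_derivative - exp (- l * \<bar>x - y\<bar>)) (at y)"
      by (rule DERIV_cong[OF DERIV_chain2[where g="\<lambda>y. x - y" and f="exp_abs_primitive l",
              OF DERIV_exp_abs_primitive[OF assms(1)]]])
        (auto intro!: derivative_eq_intros)
    from DERIV_minus[OF this]
    show "((\<lambda>y. - exp_abs_primitive l (x - y)) has_real_derivative exp (- l * \<bar>x - y\<bar>)) (at y)"
      by simp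
  qed (use assms in \<open>auto intro!: continuous_intros\<close>)
  finally show "?I \<le> 2 / l"
    using abs_exp_abs_primitive_le[OF assms(1), of "x - a"] abs_exp_abs_primitive_le[OF assms(1), of "x + a"]
    by simp
  have "?I \<le> (LINT y|lborel. indicator {-a..a} y)"
    unfolding I
  proof (rule integral_mono)
    show "integrable lborel (\<lambda>y. exp (- l * \<bar>x - y\<bar>) * indicator {-a..a} y)"
    proof -
      have "continuous_on {-a..a} (\<lambda>y. exp (- l * \<bar>x - y\<bar>))" by (intro continuous_intros)
      from borel_integrable_atLeastAtMost'[OF this] show ?thesis
        by (simp add: set_integrable_def mult.commute)
    qed
    show "integrable lborel (indicator {-a..a} :: real \<Rightarrow> real)"
      using assms by (simp add: emeasure_lborel_Icc_eq)
    show "exp (- l * \<bar>x - y\<bar>) * indicator {-a..a} y \<le> indicator {-a..a} y" for y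
      using assms by (auto simp: indicator_def)
  qed
  then show "?I \<le> 2 * a" using assms by simp
qed

section \<open>Partial sums and the choice of a short interval\<close>

definition screw_rate :: "nat \<Rightarrow> real" where
  "screw_rate n = 2 * real n + 1 / 2"

lemma screw_rate_pos: "0 < screw_rate n"
  by (simp add: screw_rate_def add_nonneg_pos)

definition partial_screw :: "real \<Rightarrow> nat \<Rightarrow> real \<Rightarrow> real" where
  "partial_screw \<kappa> m z = - 4 * (exp (z / 2) + exp (- z / 2)) + \<kappa> * \<bar>z\<bar>
     + (\<Sum>n<m. exp (- screw_rate n * \<bar>z\<bar>) / (screw_rate n)\<^sup>2)"

text \<open>The second derivative of \<open>partial_screw\<close> after removal of its corner, which
  is |z| times \<open>\<kappa>\<close> minus the sum of the 1/l_n. The factor 4 disappears because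
  differentiating exp(z/2) twice gives 1/4.\<close>

definition partial_density :: "nat \<Rightarrow> real \<Rightarrow> real" where
  "partial_density m z = (\<Sum>n<m. exp (- screw_rate n * \<bar>z\<bar>)) - (exp (z / 2) + exp (- z / 2))"

text \<open>Each exponential with index at least \<open>m\<^sub>0\<close> costs at most 2/l_n,
  exactly what it adds on the right. So it suffices to gain enough from the first
  \<open>m\<^sub>0\<close> terms, and \<open>a\<^sub>0\<close> can be chosen independently of
  \<open>m\<close>.\<close>

lemma partial_density_integral_le:
  "\<exists>a\<^sub>0>0. \<exists>m\<^sub>0. \<forall>a m. 0 < a \<longrightarrow> a < a\<^sub>0 \<longrightarrow> m\<^sub>0 \<le> m \<longrightarrow> (\<forall>x\<in>{-a..a}.
     (LINT y|restrict_space lborel {-a..a}. \<bar>partial_density m (x - y)\<bar>)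
       \<le> 2 * ((\<Sum>n<m. 1 / screw_rate n) - \<kappa>) - 1)"
proof -
  have "\<not> summable (\<lambda>n. 1 / screw_rate n)"
  proof
    assume "summable (\<lambda>n. 1 / screw_rate n)"
    \<comment> \<open>The factor 2 makes the comparison work: 2/(2n + 1/2) is at least 1/(n +
      1).\<close>
    then have "summable (\<lambda>n. 2 * (1 / screw_rate n))" by (rule summable_mult)
    then have "summable (\<lambda>n. 1 / real (Suc n))"
      by (rule summable_comparison_test') (auto simp: screw_rate_def field_simps)
    then show False using not_summable_harmonic[where 'a=real]
      by (subst (asm) summable_Suc_iff) (simp add: inverse_eq_divide)
  qed
  \<comment> \<open>The surplus 2 has two uses: 1 pays for the terms proportional to
    \<open>a\<close>, and 1 remains as the coercivity constant.\<close>
  then have "\<exists>m. 2 * \<kappa> + 2 < 2 * (\<Sum>n<m. 1 / screw_rate n)"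
  proof (rule contrapos_np)
    assume *: "\<not> (\<exists>m. 2 * \<kappa> + 2 < 2 * (\<Sum>n<m. 1 / screw_rate n))"
    show "summable (\<lambda>n. 1 / screw_rate n)"
    proof (rule summableI_nonneg_bounded[where x="\<kappa> + 1"])
      show "0 \<le> 1 / screw_rate n" for n using screw_rate_pos[of n] by simp
      show "(\<Sum>n<m. 1 / screw_rate n) \<le> \<kappa> + 1" for m
        using *[unfolded not_ex, rule_format, of m] by linarith
    qed
  qed
  then obtain m\<^sub>0 where m0: "2 * \<kappa> + 2 < 2 * (\<Sum>n<m\<^sub>0. 1 / screw_rate n)" by blast
  \<comment> \<open>This makes 2a(6 + \<open>m\<^sub>0\<close>) at most 1: each of the first
    \<open>m\<^sub>0\<close> exponentials costs at most 2a, and the part bounded by 6 costs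
    12a.\<close>
  define a\<^sub>0 where "a\<^sub>0 = 1 / (2 * (6 + real m\<^sub>0))"
  have "(LINT y|restrict_space lborel {-a..a}. \<bar>partial_density m (x - y)\<bar>)
       \<le> 2 * ((\<Sum>n<m. 1 / screw_rate n) - \<kappa>) - 1"
    if a: "0 < a" "a < a\<^sub>0" and m: "m\<^sub>0 \<le> m" and x: "x \<in> {-a..a}" for a m x
  proof -
    let ?N = "restrict_space lborel {-a..a}"
    interpret N: finite_measure ?N by (rule finite_measure_interval)
    have a1: "2 * a * (6 + real m\<^sub>0) \<le> 1" "a \<le> 1"
      using a by (auto simp: a\<^sub>0_def field_simps add_nonneg_pos)
        (smt (verit) mult_nonneg_nonneg of_nat_0_le_iff)
    have int_e: "integrable ?N (\<lambda>y. exp (- screw_rate n * \<bar>x - y\<bar>))" for n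
      using screw_rate_pos[of n] by (intro N.integrable_const_bound[of _ 1]) auto
    have "(LINT y|?N. \<bar>partial_density m (x - y)\<bar>)
        \<le> (LINT y|?N. (\<Sum>n<m. exp (- screw_rate n * \<bar>x - y\<bar>)) + 6)"
    proof (rule integral_mono')
      show "integrable ?N (\<lambda>y. (\<Sum>n<m. exp (- screw_rate n * \<bar>x - y\<bar>)) + 6)"
        by (intro Bochner_Integration.integrable_add Bochner_Integration.integrable_sum int_e) auto
      fix y assume "y \<in> space ?N"
      then have "\<bar>x - y\<bar> \<le> 2" using x a1 by (auto simp: space_restrict_space)
      then have "exp ((x - y) / 2) \<le> exp 1" "exp (- (x - y) / 2) \<le> exp (1::real)" by auto
      \<comment> \<open>Both exponents are at most 1 and e \<le> 3, whence the constant 6.\<close>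
      then have "exp ((x - y) / 2) + exp (- (x - y) / 2) \<le> 6" using exp_le by linarith
      moreover have "0 < exp ((x - y) / 2)" "0 < exp (- (x - y) / 2)"
        "0 \<le> (\<Sum>n<m. exp (- screw_rate n * \<bar>x - y\<bar>))" by (auto intro: sum_nonneg)
      ultimately show "\<bar>partial_density m (x - y)\<bar> \<le> (\<Sum>n<m. exp (- screw_rate n * \<bar>x - y\<bar>)) + 6"
        unfolding partial_density_def by linarith
    qed (auto intro!: add_nonneg_nonneg sum_nonneg)
    also have "\<dots> = (\<Sum>n<m. LINT y|?N. exp (- screw_rate n * \<bar>x - y\<bar>)) + 6 * (2 * a)"
      using a int_e
      by (subst Bochner_Integration.integral_add)
        (auto simp: Bochner_Integration.integral_sum measure_restrict_space space_restrict_space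
          intro!: Bochner_Integration.integrable_sum)
    also have "(\<Sum>n<m. LINT y|?N. exp (- screw_rate n * \<bar>x - y\<bar>))
        = (\<Sum>n<m\<^sub>0. LINT y|?N. exp (- screw_rate n * \<bar>x - y\<bar>))
        + (\<Sum>n=m\<^sub>0..<m. LINT y|?N. exp (- screw_rate n * \<bar>x - y\<bar>))"
      using m by (simp add: lessThan_atLeast0 sum.atLeastLessThan_concat)
    also have "(\<Sum>n<m\<^sub>0. LINT y|?N. exp (- screw_rate n * \<bar>x - y\<bar>)) \<le> (\<Sum>n<m\<^sub>0. 2 * a)"
      using a by (intro sum_mono integral_exp_abs_le(2) screw_rate_pos) auto
    also have "(\<Sum>n=m\<^sub>0..<m. LINT y|?N. exp (- screw_rate n * \<bar>x - y\<bar>))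
        \<le> (\<Sum>n=m\<^sub>0..<m. 2 * (1 / screw_rate n))"
      using a integral_exp_abs_le(1)[OF screw_rate_pos, of a] by (intro sum_mono) simp
    also have "\<dots> = 2 * (\<Sum>n<m. 1 / screw_rate n) - 2 * (\<Sum>n<m\<^sub>0. 1 / screw_rate n)"
      using m sum.atLeastLessThan_concat[of 0 m\<^sub>0 m "\<lambda>n. 2 * (1 / screw_rate n)"]
      by (simp add: lessThan_atLeast0 sum_distrib_left)
    finally show ?thesis using m0 a1(1) by (simp add: algebra_simps)
  qed
  moreover have "0 < a\<^sub>0" by (simp add: a\<^sub>0_def add_pos_nonneg)
  ultimately show ?thesis by blast
qed

text \<open>Moving |z|/l_n into each exponential term makes it twice differentiable and leaves a
  negative multiple of |z|. With the assumed Schur bound, -2 \<open>\<gamma>\<close> -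
  \<open>S\<close> is exactly 1, whatever \<open>m\<close> is.\<close>

lemma partial_screw_form_coercive:
  fixes \<xi> :: "'a \<Rightarrow> complex"
  assumes S: "\<And>x. x \<in> {-a..a} \<Longrightarrow> (LINT y|restrict_space lborel {-a..a}. \<bar>partial_density m (x - y)\<bar>)
       \<le> 2 * ((\<Sum>n<m. 1 / screw_rate n) - \<kappa>) - 1"
    and M: "sigma_finite_measure M" and \<tau>: "\<tau> \<in> borel_measurable M"
    and \<tau>_le: "\<And>\<omega>. \<omega> \<in> space M \<Longrightarrow> \<bar>\<tau> \<omega>\<bar> \<le> a" and \<xi>: "integrable M \<xi>"
  defines "Q \<equiv> LINT \<omega>|M. LINT \<omega>'|M.
      of_real (real_screw_kernel (partial_screw \<kappa> m) (\<tau> \<omega>) (\<tau> \<omega>')) * \<xi> \<omega>' * cnj (\<xi> \<omega>)"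
  shows "(LINT x|restrict_space lborel {-a..a}. (cmod (LINT \<omega>|M. \<xi> \<omega> * of_real (step (\<tau> \<omega>) x)))\<^sup>2) \<le> Re Q"
    and "Im Q = 0"
proof -
  define L where "L = (\<lambda>z. (\<Sum>n<m. exp (- screw_rate n * \<bar>z\<bar>) / (screw_rate n)\<^sup>2 + \<bar>z\<bar> / screw_rate n)
    - 4 * (exp (z / 2) + exp (- z / 2)))"
  define H where "H = (\<lambda>z. (\<Sum>n<m. exp_abs_primitive (screw_rate n) z) - 2 * (exp (z / 2) - exp (- z / 2)))"
  \<comment> \<open>The coefficient of |z| that remains once \<open>L\<close> has absorbed every
    |z|/l_n.\<close>
  define \<gamma> where "\<gamma> = \<kappa> - (\<Sum>n<m. 1 / screw_rate n)"
  have cont: "isCont (partial_density m) x" for x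
    unfolding partial_density_def by (intro continuous_intros) auto
  have "compact (partial_density m ` {-(2*a)..2*a})"
    using cont by (intro compact_continuous_image continuous_at_imp_continuous_on) auto
  then obtain K where K: "\<forall>z\<in>{-(2*a)..2*a}. \<bar>partial_density m z\<bar> \<le> K"
    using compact_imp_bounded[of "partial_density m ` {-(2*a)..2*a}"] unfolding bounded_iff by auto
  interpret difference_kernel a K "partial_density m"
  proof
    show "\<bar>partial_density m z\<bar> \<le> K" if "\<bar>z\<bar> \<le> 2 * a" for z
      using K that by (simp add: abs_le_iff)
  qed (rule cont)
  have L: "(L has_real_derivative H z) (at z)" for z
    unfolding L_def H_def
    by (intro DERIV_diff DERIV_sum DERIV_exp_abs_primitive2 screw_rate_pos)
      (auto intro!: derivative_eq_intros)
  have H: "(H has_real_derivative partial_density m z) (at z)" for z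
    unfolding H_def partial_density_def
    by (intro DERIV_diff DERIV_sum DERIV_exp_abs_primitive screw_rate_pos)
      (auto intro!: derivative_eq_intros)
  have even: "partial_density m (- z) = partial_density m z" for z
    by (simp add: partial_density_def)
  have eq: "(\<lambda>z. L z + \<gamma> * \<bar>z\<bar>) = partial_screw \<kappa> m"
    by (auto simp: L_def \<gamma>_def partial_screw_def sum.distrib algebra_simps sum_distrib_left)
  have factor: "- 2 * \<gamma> - (2 * ((\<Sum>n<m. 1 / screw_rate n) - \<kappa>) - 1) = 1"
    by (simp add: \<gamma>_def)
  from screw_form_coercive[OF L H even S[folded N_def] M \<tau> \<tau>_le \<xi>, of \<gamma>]
  show "(LINT x|restrict_space lborel {-a..a}. (cmod (LINT \<omega>|M. \<xi> \<omega> * of_real (step (\<tau> \<omega>) x)))\<^sup>2) \<le> Re Q"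
    and "Im Q = 0"
    unfolding eq Q_def N_def factor mult_1_left by simp_all
qed

subsection \<open>Injectivity of the step transform\<close>

lemma sigma_finite_lebesgue: "sigma_finite_measure (lebesgue :: 'a::euclidean_space measure)"
proof
  obtain A :: "'a set set" where "countable A" "A \<subseteq> sets lborel" "\<Union>A = space lborel"
    "\<forall>a\<in>A. emeasure lborel a \<noteq> \<infinity>"
    using lborel.sigma_finite_countable by blast
  then show "\<exists>A::'a set set. countable A \<and> A \<subseteq> sets lebesgue \<and> \<Union>A = space lebesgue \<and>
      (\<forall>a\<in>A. emeasure lebesgue a \<noteq> \<infinity>)"
    by (intro exI[of _ A]) (auto simp: subset_eq emeasure_completion)
qed

text \<open>Open rays form an intersection-stable generator of the Borel sets, so the integral
  vanishes over every Borel set; a Lebesgue set differs from a Borel set by a null set. Uniqueness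
  of densities then applies.\<close>

lemma AE_zero_if_integral_greaterThan_zero:
  fixes f :: "real \<Rightarrow> complex"
  assumes f: "integrable lebesgue f" and total: "integral\<^sup>L lebesgue f = 0"
    and gt: "\<And>x. set_lebesgue_integral lebesgue {x<..} f = 0"
  shows "AE x in lebesgue. f x = 0"
proof (rule sigma_finite_measure.density_unique_banach[OF sigma_finite_lebesgue f integrable_zero])
  have sint: "set_integrable lebesgue A f" if "A \<in> sets lebesgue" for A
    using integrable_mult_indicator[OF that f] by (simp add: set_integrable_def)
  have borel: "set_lebesgue_integral lebesgue A f = 0" if "A \<in> sets borel" for A
  proof -
    have sets: "sets borel = sigma_sets UNIV (range greaterThan :: real set set)"
      using arg_cong[OF borel_Ioi, of sets] by simp
    have stable: "Int_stable (range greaterThan :: real set set)"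
    proof -
      have "{x<..} \<inter> {y<..} = {max x y<..}" for x y :: real by auto
      then show ?thesis by (auto simp: Int_stable_def)
    qed
    have sub: "range greaterThan \<subseteq> Pow (UNIV :: real set)" by simp
    have "A \<in> sigma_sets UNIV (range greaterThan)" using that sets by simp
    with stable sub show ?thesis
    proof (induction rule: sigma_sets_induct_disjoint)
      \<comment> \<open>The integral over a complement is the total integral minus that over the
        set; here \<open>total\<close> enters.\<close>
      case (compl A)
      then have A: "A \<in> sets lebesgue" using sets by (metis sets_completionI_sets sets_lborel)
      have "set_lebesgue_integral lebesgue (A \<union> (UNIV - A)) f
          = set_lebesgue_integral lebesgue A f + set_lebesgue_integral lebesgue (UNIV - A) f"
        by (rule set_integral_Un) (use A sets.compl_sets[OF A] in \<open>auto intro!: sint\<close>)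
      then show ?case
        using compl.IH total by (simp add: set_lebesgue_integral_def)
    next
      case (union A)
      then have "range A \<subseteq> sets lebesgue" using sets by (metis sets_completionI_sets sets_lborel subsetD subsetI)
      then have "set_lebesgue_integral lebesgue (\<Union>i. A i) f = (\<Sum>i. set_lebesgue_integral lebesgue (A i) f)"
        using union.hyps
        by (intro lebesgue_integral_countable_add sint sets.countable_UN) (auto simp: disjoint_family_on_def)
      then show ?case using union.IH by simp
    qed (use gt in \<open>auto simp: set_lebesgue_integral_def\<close>)
  qed
  fix A :: "real set" assume "A \<in> sets lebesgue"
  then obtain S N N' where A: "A = S \<union> N" "N \<subseteq> N'" "N' \<in> null_sets lborel" "S \<in> sets lborel"
    by (rule sets_completionE)
  have "AE x in lebesgue. x \<notin> N'"
    using A(3) by (intro AE_completion AE_not_in)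
  then have "AE x in lebesgue. indicator A x *\<^sub>R f x = indicator S x *\<^sub>R f x"
    by eventually_elim (use A(1,2) in \<open>auto simp: indicator_def\<close>)
  then have "set_lebesgue_integral lebesgue A f = set_lebesgue_integral lebesgue S f"
    unfolding set_lebesgue_integral_def
    using \<open>A \<in> sets lebesgue\<close> sint[of A] sint[of S] A(4)
    by (intro integral_cong_AE) (auto simp: set_integrable_def)
  also have "\<dots> = 0" using borel A(4) by simp
  finally show "set_lebesgue_integral lebesgue A f = set_lebesgue_integral lebesgue A (\<lambda>x. 0)"
    by (simp add: set_lebesgue_integral_def)
qed

text \<open>A nonempty open interval is not null. The lemma supplies points where the step transform
  vanishes, arbitrarily close to a prescribed point and on a prescribed side.\<close>

lemma AE_interval_obtains:
  fixes p q a :: real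
  assumes "AE x in restrict_space lborel {-a..a}. P x" "-a \<le> p" "p < q" "q \<le> a"
  obtains x where "p < x" "x < q" "P x"
proof -
  have "\<exists>x. p < x \<and> x < q \<and> P x"
  proof (rule ccontr)
    assume "\<not> ?thesis"
    moreover have "AE x in lborel. x \<in> {-a..a} \<longrightarrow> P x"
      using assms(1) by (subst (asm) AE_restrict_space_iff) auto
    ultimately have "AE x in lborel. x \<notin> {p<..<q}"
      by (elim eventually_mono) (use assms in auto)
    then have "{p<..<q} \<in> null_sets lborel" by (subst AE_iff_null_sets) auto
    then show False using assms by (auto simp: null_sets_def)
  qed
  then show ?thesis using that by blast
qed

text \<open>At x > 0 the transform is the integral of \<open>f\<close> over [x, oo), and at x < 0 it
  is minus the integral over (-oo, x]. Limits along points where it vanishes make all integrals over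
  open rays pointing away from 0 vanish, hence the total integral and then the integrals over all
  right rays.\<close>

lemma AE_zero_if_step_transform_zero:
  fixes f :: "real \<Rightarrow> complex"
  assumes f: "integrable lebesgue f" and supp: "\<And>t. a \<le> \<bar>t\<bar> \<Longrightarrow> f t = 0" and a: "0 < a"
    and zero: "AE x in restrict_space lborel {-a..a}. (LINT t|lebesgue. f t * of_real (step t x)) = 0"
  shows "AE t in lebesgue. f t = 0"
proof -
  have [measurable]: "f \<in> borel_measurable lebesgue" using f by auto
  have step_meas [measurable]: "(\<lambda>t. step t x) \<in> borel_measurable lebesgue" for x
    using step_measurable'[of "\<lambda>t. t" lborel "\<lambda>_. x"] by (intro measurable_completion) auto
  have limit_zero: "(LINT t|lebesgue. f t * of_real (s t)) = 0"
    if y: "\<And>j. (LINT t|lebesgue. f t * of_real (step t (y j))) = 0"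
      and s: "\<And>t. (\<lambda>j. step t (y j)) \<longlonglongrightarrow> s t" for y :: "nat \<Rightarrow> real" and s
  proof -
    have [measurable]: "s \<in> borel_measurable lebesgue"
      by (rule borel_measurable_LIMSEQ_real[OF s step_meas])
    have "(\<lambda>j. LINT t|lebesgue. f t * of_real (step t (y j))) \<longlonglongrightarrow> (LINT t|lebesgue. f t * of_real (s t))"
    proof (rule integral_dominated_convergence[where w="\<lambda>t. cmod (f t)"])
      show "AE t in lebesgue. (\<lambda>j. f t * of_real (step t (y j))) \<longlonglongrightarrow> f t * of_real (s t)"
        using s by (auto intro!: tendsto_intros)
      show "AE t in lebesgue. cmod (f t * of_real (step t (y j))) \<le> cmod (f t)" for j
        using mult_left_mono[OF abs_step_le_1, of "cmod (f t)" t "y j" for t] by (auto simp: norm_mult)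
    qed (use f in auto)
    then show ?thesis using y by (simp add: LIMSEQ_const_iff)
  qed
  have right: "(LINT t|lebesgue. f t * of_real (indicator {x<..} t)) = 0" if x: "0 \<le> x" for x
  proof (cases "x < a")
    case True
    \<comment> \<open>Approaching \<open>x\<close> strictly from the right makes the steps converge
      everywhere to the indicator of the open ray; at \<open>t = x\<close> they are already
      0.\<close>
    have "\<exists>y. x < y \<and> y < min a (x + inverse (real (Suc j))) \<and> (LINT t|lebesgue. f t * of_real (step t y)) = 0" for j
      by (rule AE_interval_obtains[OF zero, of x "min a (x + inverse (real (Suc j)))"]) (use x True a in auto)
    then obtain y where y: "x < y j" "y j < min a (x + inverse (real (Suc j)))"
      "(LINT t|lebesgue. f t * of_real (step t (y j))) = 0" for j by metis
    have y_lim: "y \<longlonglongrightarrow> x"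
    proof (rule tendsto_sandwich[of "\<lambda>_. x" _ _ "\<lambda>j. x + inverse (real (Suc j))"])
      show "(\<lambda>j. x + inverse (real (Suc j))) \<longlonglongrightarrow> x"
        using tendsto_add[OF tendsto_const LIMSEQ_inverse_real_of_nat, of x] by simp
    qed (use y(1,2) in \<open>auto simp: less_imp_le\<close>)
    show ?thesis
    proof (rule limit_zero[OF y(3)])
      fix t
      show "(\<lambda>j. step t (y j)) \<longlonglongrightarrow> indicator {x<..} t"
      proof (cases "x < t")
        case True
        have "eventually (\<lambda>j. step t (y j) = 1) sequentially"
          using order_tendstoD(2)[OF y_lim True]
        proof eventually_elim
          case (elim j)
          then show ?case using x y(1)[of j] True by (auto simp: step_def)
        qed
        then show ?thesis using True by (auto intro: tendsto_eventually)
      next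
        case False
        then have "step t (y j) = 0" for j using x y(1)[of j] by (auto simp: step_def)
        then show ?thesis using False by simp
      qed
    qed
  next
    case False
    then have "(\<lambda>t. f t * of_real (indicator {x<..} t)) = (\<lambda>_. 0)"
      using supp x by (intro ext) (auto simp: indicator_def)
    then show ?thesis by (simp only: integral_zero)
  qed
  have left: "(LINT t|lebesgue. f t * of_real (indicator {..<x} t)) = 0" if x: "x \<le> 0" for x
  proof (cases "- a < x")
    case True
    have "\<exists>y. max (-a) (x - inverse (real (Suc j))) < y \<and> y < x \<and> (LINT t|lebesgue. f t * of_real (step t y)) = 0" for j
      by (rule AE_interval_obtains[OF zero, of "max (-a) (x - inverse (real (Suc j)))" x]) (use x True a in auto)
    then obtain y where y: "max (-a) (x - inverse (real (Suc j))) < y j" "y j < x"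
      "(LINT t|lebesgue. f t * of_real (step t (y j))) = 0" for j by metis
    have y_lim: "y \<longlonglongrightarrow> x"
    proof (rule tendsto_sandwich[of "\<lambda>j. x - inverse (real (Suc j))" _ _ "\<lambda>_. x"])
      show "(\<lambda>j. x - inverse (real (Suc j))) \<longlonglongrightarrow> x"
        using tendsto_diff[OF tendsto_const LIMSEQ_inverse_real_of_nat, of x] by simp
    qed (use y(1,2) in \<open>auto simp: less_imp_le\<close>)
    \<comment> \<open>The mirror image on the negative side, where steps carry the sign -1.\<close>
    have "(LINT t|lebesgue. f t * of_real (- indicator {..<x} t)) = 0"
    proof (rule limit_zero[OF y(3)])
      fix t
      show "(\<lambda>j. step t (y j)) \<longlonglongrightarrow> - indicator {..<x} t"
      proof (cases "t < x")
        case True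
        have "eventually (\<lambda>j. step t (y j) = - 1) sequentially"
          using order_tendstoD(1)[OF y_lim True]
        proof eventually_elim
          case (elim j)
          then show ?case using x y(2)[of j] True by (auto simp: step_def)
        qed
        then show ?thesis using True by (auto intro: tendsto_eventually)
      next
        case False
        then have "step t (y j) = 0" for j using x y(2)[of j] by (auto simp: step_def)
        then show ?thesis using False by simp
      qed
    qed
    then show ?thesis by simp
  next
    case False
    then have "(\<lambda>t. f t * of_real (indicator {..<x} t)) = (\<lambda>_. 0)"
      using supp x by (intro ext) (auto simp: indicator_def)
    then show ?thesis by (simp only: integral_zero)
  qed
  have sum: "integral\<^sup>L lebesgue f = (LINT t|lebesgue. f t * of_real (indicator {x<..} t))
      + (LINT t|lebesgue. f t * of_real (indicator {..<x} t))" for x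
  proof -
    have int: "integrable lebesgue (\<lambda>t. f t * of_real (indicator A t))" if "A \<in> sets lebesgue" for A
      using integrable_mult_indicator[OF that f] by (simp add: scaleR_conv_of_real mult.commute)
    have "AE t in lebesgue. t \<noteq> x" by (intro AE_completion AE_lborel_singleton)
    then have "AE t in lebesgue. f t = f t * of_real (indicator {x<..} t) + f t * of_real (indicator {..<x} t)"
      by eventually_elim (auto simp: indicator_def)
    then have "integral\<^sup>L lebesgue f
        = (LINT t|lebesgue. f t * of_real (indicator {x<..} t) + f t * of_real (indicator {..<x} t))"
      by (intro integral_cong_AE borel_measurable_add borel_measurable_integrable f int) auto
    also have "\<dots> = (LINT t|lebesgue. f t * of_real (indicator {x<..} t))
      + (LINT t|lebesgue. f t * of_real (indicator {..<x} t))"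
      by (intro Bochner_Integration.integral_add int) auto
    finally show ?thesis .
  qed
  \<comment> \<open>At 0 both rays point away from the origin, so both parts are known to
    vanish.\<close>
  have total: "integral\<^sup>L lebesgue f = 0"
    using sum[of 0] left[of 0] right[of 0] by simp
  show ?thesis
  proof (rule AE_zero_if_integral_greaterThan_zero[OF f total])
    fix x
    have "(LINT t|lebesgue. f t * of_real (indicator {x<..} t)) = 0"
      using right[of x] sum[of x] left[of x] total by (cases "0 \<le> x") auto
    then show "set_lebesgue_integral lebesgue {x<..} f = 0"
      by (simp add: set_lebesgue_integral_def scaleR_conv_of_real mult.commute)
  qed
qed

subsection \<open>Passage to the limit\<close>

lemma real_screw_kernel_measurable [measurable (raw)]:
  assumes [measurable]: "h \<in> borel_measurable borel" "f \<in> borel_measurable M" "g \<in> borel_measurable M"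
  shows "(\<lambda>x. real_screw_kernel h (f x) (g x)) \<in> borel_measurable M"
  unfolding real_screw_kernel_def by measurable

definition full_screw :: "real \<Rightarrow> real \<Rightarrow> real" where
  "full_screw \<kappa> z = - 4 * (exp (z / 2) + exp (- z / 2)) + \<kappa> * \<bar>z\<bar>
     + (\<Sum>n. exp (- screw_rate n * \<bar>z\<bar>) / (screw_rate n)\<^sup>2)"

lemma summable_inverse_screw_rate_square: "summable (\<lambda>n. 1 / (screw_rate n)\<^sup>2)"
proof -
  have "summable (\<lambda>n. 4 * inverse ((real (Suc n))\<^sup>2))"
    by (intro summable_mult summable_Suc_iff[where f="\<lambda>n. inverse ((real n)\<^sup>2)", THEN iffD2]
        inverse_power_summable) auto
  then show ?thesis
  proof (rule summable_comparison_test')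
    fix n :: nat
    \<comment> \<open>From (n + 1)/2 \<le> 2n + 1/2, which is an equality at n = 0.\<close>
    have "(real (Suc n) / 2)\<^sup>2 \<le> (screw_rate n)\<^sup>2"
      by (rule power_mono) (auto simp: screw_rate_def)
    then have "1 / (screw_rate n)\<^sup>2 \<le> 1 / (real (Suc n) / 2)\<^sup>2"
      by (intro divide_left_mono) (use screw_rate_pos[of n] in auto)
    then show "norm (1 / (screw_rate n)\<^sup>2) \<le> 4 * inverse ((real (Suc n))\<^sup>2)"
      by (simp add: power_divide inverse_eq_divide)
  qed
qed

lemma screw_term_le: "\<bar>exp (- screw_rate n * \<bar>z\<bar>) / (screw_rate n)\<^sup>2\<bar> \<le> 1 / (screw_rate n)\<^sup>2"
  using screw_rate_pos[of n] by (simp add: divide_right_mono)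

text \<open>The Weierstrass test with majorant 1/l_n^2. It gives both the pointwise limit and the
  continuity of \<open>full_screw\<close>.\<close>

lemma uniform_limit_screw_terms:
  "uniform_limit UNIV (\<lambda>m z. \<Sum>n<m. exp (- screw_rate n * \<bar>z\<bar>) / (screw_rate n)\<^sup>2)
     (\<lambda>z. \<Sum>n. exp (- screw_rate n * \<bar>z\<bar>) / (screw_rate n)\<^sup>2) sequentially"
  by (rule Weierstrass_m_test[OF _ summable_inverse_screw_rate_square])
    (use screw_term_le in simp)

lemma partial_screw_LIMSEQ: "(\<lambda>m. partial_screw \<kappa> m z) \<longlonglongrightarrow> full_screw \<kappa> z"
  unfolding partial_screw_def full_screw_def
  by (intro tendsto_intros tendsto_uniform_limitI[OF uniform_limit_screw_terms]) auto

lemma continuous_on_full_screw: "continuous_on UNIV (full_screw \<kappa>)"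
proof -
  have "continuous_on UNIV (\<lambda>z. \<Sum>n. exp (- screw_rate n * \<bar>z\<bar>) / (screw_rate n)\<^sup>2)"
    using screw_rate_pos
    by (intro uniform_limit_theorem[OF _ uniform_limit_screw_terms] always_eventually allI continuous_intros)
      (auto simp: less_imp_neq[symmetric])
  then show ?thesis
    unfolding full_screw_def by (intro continuous_intros) auto
qed

lemma partial_screw_measurable [measurable]: "partial_screw \<kappa> m \<in> borel_measurable borel"
  unfolding partial_screw_def by measurable

lemma full_screw_measurable [measurable]: "full_screw \<kappa> \<in> borel_measurable borel"
  by (rule borel_measurable_continuous_onI[OF continuous_on_full_screw])

text \<open>A majorant independent of \<open>m\<close> for dominated convergence. The range |z|
  \<le> 2 contains all differences of points of [-1, 1], and 24 is 4 times the bound 6 for the two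
  exponentials.\<close>

lemma partial_screw_bound:
  assumes "\<bar>z\<bar> \<le> 2"
  shows "\<bar>partial_screw \<kappa> m z\<bar> \<le> 24 + 2 * \<bar>\<kappa>\<bar> + (\<Sum>n. 1 / (screw_rate n)\<^sup>2)"
proof -
  have "exp (z / 2) \<le> exp 1" "exp (- z / 2) \<le> exp (1::real)" using assms by auto
  then have "exp (z / 2) + exp (- z / 2) \<le> 6" using exp_le by linarith
  moreover have "0 < exp (z / 2)" "0 < exp (- z / 2)" by auto
  moreover have "\<bar>\<kappa> * \<bar>z\<bar>\<bar> \<le> \<bar>\<kappa>\<bar> * 2"
    using assms by (auto simp: abs_mult intro!: mult_left_mono)
  moreover have "\<bar>\<Sum>n<m. exp (- screw_rate n * \<bar>z\<bar>) / (screw_rate n)\<^sup>2\<bar> \<le> (\<Sum>n<m. 1 / (screw_rate n)\<^sup>2)"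
    by (rule order_trans[OF sum_abs sum_mono]) (rule screw_term_le)
  moreover have "(\<Sum>n<m. 1 / (screw_rate n)\<^sup>2) \<le> (\<Sum>n. 1 / (screw_rate n)\<^sup>2)"
    by (rule sum_le_suminf[OF summable_inverse_screw_rate_square]) auto
  moreover have "\<bar>- 4 * E + k + S\<bar> \<le> 24 + K + R"
    if "E \<le> 6" "0 < E" "\<bar>k\<bar> \<le> K" "\<bar>S\<bar> \<le> R" for E k S K R :: real
    using that by linarith
  ultimately show ?thesis unfolding partial_screw_def
    by (metis (no_types, lifting) add_pos_pos mult.commute order_trans)
qed

text \<open>Dominated convergence in the inner and then in the outer integral.\<close>

lemma full_screw_form_LIMSEQ:
  fixes \<xi> :: "'a \<Rightarrow> complex"
  assumes M: "sigma_finite_measure M" and \<tau> [measurable]: "\<tau> \<in> borel_measurable M"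
    and \<tau>_le: "\<And>\<omega>. \<omega> \<in> space M \<Longrightarrow> \<bar>\<tau> \<omega>\<bar> \<le> 1" and \<xi>: "integrable M \<xi>"
  shows "(\<lambda>m. LINT \<omega>|M. LINT \<omega>'|M.
      of_real (real_screw_kernel (partial_screw \<kappa> m) (\<tau> \<omega>) (\<tau> \<omega>')) * \<xi> \<omega>' * cnj (\<xi> \<omega>))
    \<longlonglongrightarrow> (LINT \<omega>|M. LINT \<omega>'|M.
      of_real (real_screw_kernel (full_screw \<kappa>) (\<tau> \<omega>) (\<tau> \<omega>')) * \<xi> \<omega>' * cnj (\<xi> \<omega>))"
proof -
  interpret sigma_finite_measure M by fact
  have [measurable]: "\<xi> \<in> borel_measurable M" using \<xi> by auto
  define B where "B = 24 + 2 * \<bar>\<kappa>\<bar> + (\<Sum>n. 1 / (screw_rate n)\<^sup>2)"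
  define A where "A = (LINT \<omega>|M. cmod (\<xi> \<omega>))"
  let ?K = "\<lambda>m. real_screw_kernel (partial_screw \<kappa> m)"
  \<comment> \<open>The kernel is a signed sum of four values of the function, whence the factor
    4.\<close>
  have K_bound: "\<bar>?K m t u\<bar> \<le> 4 * B" if "\<bar>t\<bar> \<le> 1" "\<bar>u\<bar> \<le> 1" for m t u
  proof -
    have "\<bar>t - u\<bar> \<le> 2" "\<bar>t\<bar> \<le> 2" "\<bar>- u\<bar> \<le> 2" "\<bar>0::real\<bar> \<le> 2" using that by auto
    from this[THEN partial_screw_bound[of _ \<kappa> m, folded B_def]] show ?thesis
      unfolding real_screw_kernel_def by linarith
  qed
  have bound: "cmod (of_real (?K m (\<tau> \<omega>) (\<tau> \<omega>')) * \<xi> \<omega>' * cnj (\<xi> \<omega>)) \<le> 4 * B * cmod (\<xi> \<omega>) * cmod (\<xi> \<omega>')"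
    if "\<omega> \<in> space M" "\<omega>' \<in> space M" for m \<omega> \<omega>'
    using mult_right_mono[OF K_bound[OF \<tau>_le[OF that(1)] \<tau>_le[OF that(2)]], of "cmod (\<xi> \<omega>) * cmod (\<xi> \<omega>')" m]
    by (simp add: norm_mult mult_ac)
  have int_bound: "integrable M (\<lambda>\<omega>'. 4 * B * cmod (\<xi> \<omega>) * cmod (\<xi> \<omega>'))" for \<omega>
    using \<xi> by simp
  show ?thesis
  proof (rule integral_dominated_convergence[where w="\<lambda>\<omega>. 4 * B * cmod (\<xi> \<omega>) * A"])
    show "AE \<omega> in M. (\<lambda>m. LINT \<omega>'|M. of_real (?K m (\<tau> \<omega>) (\<tau> \<omega>')) * \<xi> \<omega>' * cnj (\<xi> \<omega>))
      \<longlonglongrightarrow> (LINT \<omega>'|M. of_real (real_screw_kernel (full_screw \<kappa>) (\<tau> \<omega>) (\<tau> \<omega>')) * \<xi> \<omega>' * cnj (\<xi> \<omega>))"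
    proof (rule AE_I2)
      fix \<omega> assume \<omega>: "\<omega> \<in> space M"
      show "(\<lambda>m. LINT \<omega>'|M. of_real (?K m (\<tau> \<omega>) (\<tau> \<omega>')) * \<xi> \<omega>' * cnj (\<xi> \<omega>))
        \<longlonglongrightarrow> (LINT \<omega>'|M. of_real (real_screw_kernel (full_screw \<kappa>) (\<tau> \<omega>) (\<tau> \<omega>')) * \<xi> \<omega>' * cnj (\<xi> \<omega>))"
      proof (rule integral_dominated_convergence[OF _ _ int_bound[of \<omega>]])
        show "AE \<omega>' in M. (\<lambda>m. of_real (?K m (\<tau> \<omega>) (\<tau> \<omega>')) * \<xi> \<omega>' * cnj (\<xi> \<omega>))
          \<longlonglongrightarrow> of_real (real_screw_kernel (full_screw \<kappa>) (\<tau> \<omega>) (\<tau> \<omega>')) * \<xi> \<omega>' * cnj (\<xi> \<omega>)"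
          unfolding real_screw_kernel_def by (intro AE_I2 tendsto_intros partial_screw_LIMSEQ)
        show "AE \<omega>' in M. cmod (of_real (?K m (\<tau> \<omega>) (\<tau> \<omega>')) * \<xi> \<omega>' * cnj (\<xi> \<omega>))
          \<le> 4 * B * cmod (\<xi> \<omega>) * cmod (\<xi> \<omega>')" for m
          by (intro AE_I2 bound \<omega>)
      qed measurable
    qed
    show "AE \<omega> in M. cmod (LINT \<omega>'|M. of_real (?K m (\<tau> \<omega>) (\<tau> \<omega>')) * \<xi> \<omega>' * cnj (\<xi> \<omega>))
      \<le> 4 * B * cmod (\<xi> \<omega>) * A" for m
    proof (rule AE_I2)
      fix \<omega> assume \<omega>: "\<omega> \<in> space M"
      have "cmod (LINT \<omega>'|M. of_real (?K m (\<tau> \<omega>) (\<tau> \<omega>')) * \<xi> \<omega>' * cnj (\<xi> \<omega>))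
          \<le> (LINT \<omega>'|M. 4 * B * cmod (\<xi> \<omega>) * cmod (\<xi> \<omega>'))"
      proof (rule norm_integral_le[OF _ int_bound bound[OF \<omega>]])
        show "integrable M (\<lambda>\<omega>'. of_real (?K m (\<tau> \<omega>) (\<tau> \<omega>')) * \<xi> \<omega>' * cnj (\<xi> \<omega>))"
        proof (rule Bochner_Integration.integrable_bound[OF int_bound[of \<omega>]])
          show "AE \<omega>' in M. cmod (of_real (?K m (\<tau> \<omega>) (\<tau> \<omega>')) * \<xi> \<omega>' * cnj (\<xi> \<omega>))
            \<le> norm (4 * B * cmod (\<xi> \<omega>) * cmod (\<xi> \<omega>'))"
            using bound[OF \<omega>] by (intro AE_I2) (metis abs_ge_self order_trans real_norm_def)
        qed measurable
      qed
      then show "cmod (LINT \<omega>'|M. of_real (?K m (\<tau> \<omega>) (\<tau> \<omega>')) * \<xi> \<omega>' * cnj (\<xi> \<omega>))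
          \<le> 4 * B * cmod (\<xi> \<omega>) * A"
        by (simp add: A_def)
    qed
    show "integrable M (\<lambda>\<omega>. 4 * B * cmod (\<xi> \<omega>) * A)"
      using \<xi> by simp
  qed measurable
qed

text \<open>The lower bound for the partial sums has a constant independent of \<open>m\<close>, so
  it survives the limit. The complex order also asserts that the form is real, which passes to the
  limit separately.\<close>

lemma full_screw_form_coercive:
  obtains a\<^sub>0 where "0 < a\<^sub>0"
    and "\<And>a (M :: 'a measure) \<tau> (\<xi> :: 'a \<Rightarrow> complex). \<lbrakk>0 < a; a < a\<^sub>0; sigma_finite_measure M; \<tau> \<in> borel_measurable M;
        \<And>\<omega>. \<omega> \<in> space M \<Longrightarrow> \<bar>\<tau> \<omega>\<bar> \<le> a; integrable M \<xi>\<rbrakk> \<Longrightarrow>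
      of_real (LINT x|restrict_space lborel {-a..a}. (cmod (LINT \<omega>|M. \<xi> \<omega> * of_real (step (\<tau> \<omega>) x)))\<^sup>2)
      \<le> (LINT \<omega>|M. LINT \<omega>'|M.
          of_real (real_screw_kernel (full_screw \<kappa>) (\<tau> \<omega>) (\<tau> \<omega>')) * \<xi> \<omega>' * cnj (\<xi> \<omega>))"
proof -
  obtain a1 m\<^sub>0 where a1: "0 < a1" and S: "\<And>a m x. 0 < a \<Longrightarrow> a < a1 \<Longrightarrow> m\<^sub>0 \<le> m \<Longrightarrow> x \<in> {-a..a} \<Longrightarrow>
     (LINT y|restrict_space lborel {-a..a}. \<bar>partial_density m (x - y)\<bar>)
       \<le> 2 * ((\<Sum>n<m. 1 / screw_rate n) - \<kappa>) - 1"
    using partial_density_integral_le[of \<kappa>] by blast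
  \<comment> \<open>The bound 1 on \<open>a\<close> keeps all values of \<open>\<tau>\<close> in the
    range where the uniform majorant is available.\<close>
  show ?thesis
  proof (rule that[of "min a1 1"])
    show "0 < min a1 1" using a1 by simp
    fix a :: real and M :: "'a measure" and \<tau> and \<xi> :: "'a \<Rightarrow> complex"
    assume a: "0 < a" "a < min a1 1" and M: "sigma_finite_measure M" and \<tau>: "\<tau> \<in> borel_measurable M"
      and \<tau>_le: "\<And>\<omega>. \<omega> \<in> space M \<Longrightarrow> \<bar>\<tau> \<omega>\<bar> \<le> a" and \<xi>: "integrable M \<xi>"
    let ?I = "LINT x|restrict_space lborel {-a..a}. (cmod (LINT \<omega>|M. \<xi> \<omega> * of_real (step (\<tau> \<omega>) x)))\<^sup>2"
    let ?Q = "\<lambda>h. LINT \<omega>|M. LINT \<omega>'|M.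
      of_real (real_screw_kernel h (\<tau> \<omega>) (\<tau> \<omega>')) * \<xi> \<omega>' * cnj (\<xi> \<omega>)"
    have partial: "?I \<le> Re (?Q (partial_screw \<kappa> m))" "Im (?Q (partial_screw \<kappa> m)) = 0" if "m\<^sub>0 \<le> m" for m
      using partial_screw_form_coercive[OF S M \<tau> \<tau>_le \<xi>, of m] a that by auto
    have "\<bar>\<tau> \<omega>\<bar> \<le> 1" if "\<omega> \<in> space M" for \<omega> using \<tau>_le[OF that] a by linarith
    note lim = full_screw_form_LIMSEQ[OF M \<tau> this \<xi>, of \<kappa>]
    have "?I \<le> Re (?Q (full_screw \<kappa>))"
      by (rule LIMSEQ_le_const[OF tendsto_Re[OF lim]]) (use partial in auto)
    moreover have "Im (?Q (full_screw \<kappa>)) = 0"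
    proof (rule LIMSEQ_unique[OF tendsto_Im[OF lim]])
      show "(\<lambda>m. Im (?Q (partial_screw \<kappa> m))) \<longlonglongrightarrow> 0"
        by (rule tendsto_eventually) (use partial in \<open>auto simp: eventually_sequentially\<close>)
    qed
    ultimately show "of_real ?I \<le> ?Q (full_screw \<kappa>)"
      by (simp add: less_eq_complex_def)
  qed
qed

section \<open>Identification of g near the origin\<close>

lemma exp_times_lerch_phi:
  "exp (- t / 2) * lerch_phi (exp (- 2 * t)) 2 (1 / 4)
    = 4 * (\<Sum>n. exp (- screw_rate n * t) / (screw_rate n)\<^sup>2)" if "0 \<le> t"
proof -
  have term_eq: "exp (- t / 2) * ((real n + 1 / 4) powr (- 2) * exp (- 2 * t) ^ n)
      = 4 * (exp (- screw_rate n * t) / (screw_rate n)\<^sup>2)" for n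
  proof -
    \<comment> \<open>Here n + 1/4 is half of \<open>screw_rate n\<close>.\<close>
    have "(real n + 1 / 4) powr (- 2) = 4 / (screw_rate n)\<^sup>2"
    proof -
      have "(screw_rate n)\<^sup>2 = 4 * (real n + 1 / 4)\<^sup>2"
        by (simp add: screw_rate_def power2_eq_square algebra_simps)
      moreover have "(real n + 1 / 4) powr (- 2) = inverse ((real n + 1 / 4)\<^sup>2)"
        by (simp only: powr_minus) (subst powr_numeral, auto)
      ultimately show ?thesis by (simp add: inverse_eq_divide)
    qed
    moreover have "exp (- t / 2) * exp (- 2 * t) ^ n = exp (- screw_rate n * t)"
      by (simp add: screw_rate_def flip: exp_of_nat_mult exp_add) (simp add: algebra_simps)
    ultimately show ?thesis by (simp add: algebra_simps)
  qed
  have sum4: "summable (\<lambda>n. exp (- screw_rate n * t) / (screw_rate n)\<^sup>2)"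
    by (rule summable_comparison_test'[OF summable_inverse_screw_rate_square])
      (use screw_term_le[of _ t] that in simp)
  \<comment> \<open>Summability of the Lerch series is recovered from the rescaled series by
    multiplying with exp(t/2); it is what permits pulling the prefactor into the sum.\<close>
  have "(\<lambda>n. (real n + 1 / 4) powr (- 2) * exp (- 2 * t) ^ n)
      = (\<lambda>n. exp (t / 2) * (4 * (exp (- screw_rate n * t) / (screw_rate n)\<^sup>2)))"
    unfolding term_eq[symmetric] by (simp add: mult.assoc[symmetric] flip: exp_add)
  then have "summable (\<lambda>n. (real n + 1 / 4) powr (- 2) * exp (- 2 * t) ^ n)"
    by (simp only:) (intro summable_mult sum4)
  from suminf_mult[OF this, of "exp (- t / 2)"] suminf_mult[OF sum4, of 4]
  show ?thesis
    unfolding lerch_phi_def term_eq by simp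
qed

text \<open>Below ln 2 no prime power reaches the von Mangoldt sum, which therefore vanishes; the
  remaining terms are an exponential part, a multiple of |t|, the Lerch series and
  constants.\<close>

lemma screw_g_eq_full_screw:
  obtains \<kappa> c where "\<And>t. \<bar>t\<bar> < ln 2 \<Longrightarrow> screw_g t = of_real (full_screw \<kappa> t + c)"
proof
  fix t :: real assume t: "\<bar>t\<bar> < ln 2"
  have "exp \<bar>t\<bar> < 2" using t by (metis exp_less_mono exp_ln zero_less_numeral)
  then have "real n \<le> exp \<bar>t\<bar> \<Longrightarrow> n < 2" for n :: nat by linarith
  \<comment> \<open>The only possible index is n = 1, where the von Mangoldt function is 0.\<close>
  then have "{n::nat. 1 \<le> n \<and> real n \<le> exp \<bar>t\<bar>} \<subseteq> {1}" by fastforce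
  then have "(\<Sum>n | 1 \<le> n \<and> real n \<le> exp \<bar>t\<bar>. mangoldt n / sqrt (real n) * (\<bar>t\<bar> - ln (real n))) = 0"
    by (intro sum.neutral) auto
  moreover have "exp (\<bar>t\<bar> / 2) + exp (- \<bar>t\<bar> / 2) = exp (t / 2) + exp (- t / 2)"
    by (auto simp: abs_if)
  moreover have "- (4 * (E - 2) - 0 + x / 2 * D + 1 / 4 * (C - 4 * T)) = - 4 * E + (- D / 2) * x + T + (8 - C / 4)"
    for E x D C T :: real
    by (simp add: field_simps)
  ultimately have "- Psi t = full_screw (- (Digamma (1 / 4) - ln pi) / 2) t + (8 - (pi\<^sup>2 + 8 * catalan_const) / 4)"
    unfolding Psi_def Psi_nonneg_def full_screw_def by (simp only: exp_times_lerch_phi[OF abs_ge_zero])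
  then show "screw_g t = of_real (full_screw (- (Digamma (1 / 4) - ln pi) / 2) t
      + (8 - (pi\<^sup>2 + 8 * catalan_const) / 4))"
    unfolding screw_g_def by simp
qed

text \<open>The constant \<open>c\<close> occurs twice with each sign and cancels. A general
  \<open>h\<close> covers both the screw function and its restriction to an interval.\<close>

lemma screw_kernel_eq_full_screw:
  assumes "\<And>t. \<bar>t\<bar> < r \<Longrightarrow> h t = of_real (full_screw \<kappa> t + c)"
    and "2 * a \<le> r" "\<bar>t\<bar> < a" "\<bar>u\<bar> < a"
  shows "screw_kernel h t u = of_real (real_screw_kernel (full_screw \<kappa>) t u)"
  using assms(2-) by (simp add: screw_kernel_def real_screw_kernel_def assms(1))

section \<open>Positive definiteness on L2 and membership in the screw class\<close>

theorem theorem4p2: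
  "\<exists>a\<^sub>0::real. 0 < a\<^sub>0 \<and>
     (\<forall>a::real. 0 < a \<and> a < a\<^sub>0 \<longrightarrow>
        pos_def_kernel_on {-a<..<a} (screw_kernel screw_g) \<and>
        restrict screw_g {- 2 * a..2 * a} \<in> screw_class (ereal a))"
proof -
  obtain \<kappa> c where g: "\<And>t. \<bar>t\<bar> < ln 2 \<Longrightarrow> screw_g t = of_real (full_screw \<kappa> t + c)"
    using screw_g_eq_full_screw by blast
  \<comment> \<open>The coercive estimate is taken once for measures on the reals (the L2 statement)
    and once for measures on the naturals (finite sums).\<close>
  obtain a1 where a1: "0 < a1"
    and real_form: "\<And>a (M :: real measure) \<tau> (\<xi> :: real \<Rightarrow> complex). \<lbrakk>0 < a; a < a1; sigma_finite_measure M; \<tau> \<in> borel_measurable M;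
        \<And>\<omega>. \<omega> \<in> space M \<Longrightarrow> \<bar>\<tau> \<omega>\<bar> \<le> a; integrable M \<xi>\<rbrakk> \<Longrightarrow>
      of_real (LINT x|restrict_space lborel {-a..a}. (cmod (LINT \<omega>|M. \<xi> \<omega> * of_real (step (\<tau> \<omega>) x)))\<^sup>2)
      \<le> (LINT \<omega>|M. LINT \<omega>'|M.
          of_real (real_screw_kernel (full_screw \<kappa>) (\<tau> \<omega>) (\<tau> \<omega>')) * \<xi> \<omega>' * cnj (\<xi> \<omega>))"
    by (rule full_screw_form_coercive[where \<kappa>=\<kappa> and 'a=real]) blast
  obtain a2 where a2: "0 < a2"
    and nat_form: "\<And>a (M :: nat measure) \<tau> (\<xi> :: nat \<Rightarrow> complex). \<lbrakk>0 < a; a < a2; sigma_finite_measure M; \<tau> \<in> borel_measurable M;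
        \<And>\<omega>. \<omega> \<in> space M \<Longrightarrow> \<bar>\<tau> \<omega>\<bar> \<le> a; integrable M \<xi>\<rbrakk> \<Longrightarrow>
      of_real (LINT x|restrict_space lborel {-a..a}. (cmod (LINT \<omega>|M. \<xi> \<omega> * of_real (step (\<tau> \<omega>) x)))\<^sup>2)
      \<le> (LINT \<omega>|M. LINT \<omega>'|M.
          of_real (real_screw_kernel (full_screw \<kappa>) (\<tau> \<omega>) (\<tau> \<omega>')) * \<xi> \<omega>' * cnj (\<xi> \<omega>))"
    by (rule full_screw_form_coercive[where \<kappa>=\<kappa> and 'a=nat]) blast
  \<comment> \<open>The bound ln 2 / 2 keeps every difference t - u below ln 2 in modulus, where g
    has its simple form.\<close>
  define a\<^sub>0 where "a\<^sub>0 = Min {a1, a2, ln 2 / 2}"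
  have "pos_def_kernel_on {-a<..<a} (screw_kernel screw_g)" if a: "0 < a" "a < a\<^sub>0" for a
    unfolding pos_def_kernel_on_def
  proof (intro ballI impI)
    let ?S = "{-a<..<a}" and ?N = "restrict_space lborel {-a..a}"
    let ?M = "lebesgue_on ?S"
    fix \<phi> assume \<phi>: "\<phi> \<in> L2_on ?S" and nz: "\<not> (AE t in ?M. \<phi> t = 0)"
    interpret M: finite_measure ?M by (rule finite_measure_lebesgue_on) auto
    interpret N: finite_measure ?N by (rule finite_measure_interval)
    define F where "F = (\<lambda>x. LINT t|?M. \<phi> t * of_real (step t x))"
    have space_M: "space ?M = ?S" by (simp add: space_restrict_space)
    have [measurable]: "\<phi> \<in> borel_measurable ?M" and sq: "integrable ?M (\<lambda>t. (cmod (\<phi> t))\<^sup>2)"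
      using \<phi> by (auto simp: L2_on_def)
    have id_meas [measurable]: "(\<lambda>t. t) \<in> borel_measurable ?M"
      by (intro measurable_restrict_space1 measurable_completion) simp
    \<comment> \<open>On an interval of finite measure L2 is contained in L1, by x \<le> 1 +
      x^2.\<close>
    have int_\<phi>: "integrable ?M \<phi>"
    proof (rule Bochner_Integration.integrable_bound)
      show "integrable ?M (\<lambda>t. 1 + (cmod (\<phi> t))\<^sup>2)" using sq by simp
      have "x \<le> 1 + x\<^sup>2" for x :: real using sum_squares_bound[of x 1] zero_le_power2[of x] by (simp; smt (verit))
      then show "AE t in ?M. norm (\<phi> t) \<le> norm (1 + (cmod (\<phi> t))\<^sup>2)"
        by (intro AE_I2) (auto intro: order_trans)
    qed measurable
    have "of_real (LINT x|?N. (cmod (F x))\<^sup>2)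
      \<le> (LINT t|?M. LINT u|?M. of_real (real_screw_kernel (full_screw \<kappa>) t u) * \<phi> u * cnj (\<phi> t))"
      unfolding F_def
      by (rule real_form[OF a(1) _ M.sigma_finite_measure_axioms id_meas _ int_\<phi>])
        (use a in \<open>auto simp: a\<^sub>0_def space_M\<close>)
    also have "\<dots> = (LINT t|?M. LINT u|?M. screw_kernel screw_g t u * \<phi> u * cnj (\<phi> t))"
    proof (rule Bochner_Integration.integral_cong[OF refl], rule Bochner_Integration.integral_cong[OF refl])
      fix t u assume "t \<in> space ?M" "u \<in> space ?M"
      then have "\<bar>t\<bar> < a" "\<bar>u\<bar> < a" by (auto simp: space_M)
      then have "screw_kernel screw_g t u = of_real (real_screw_kernel (full_screw \<kappa>) t u)"
        using a by (intro screw_kernel_eq_full_screw[OF g]) (auto simp: a\<^sub>0_def)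
      then show "of_real (real_screw_kernel (full_screw \<kappa>) t u) * \<phi> u * cnj (\<phi> t)
          = screw_kernel screw_g t u * \<phi> u * cnj (\<phi> t)" by simp
    qed
    finally have le: "of_real (LINT x|?N. (cmod (F x))\<^sup>2)
      \<le> (LINT t|?M. LINT u|?M. screw_kernel screw_g t u * \<phi> u * cnj (\<phi> t))" .
    have F_meas [measurable]: "F \<in> borel_measurable ?N"
      unfolding F_def by measurable
    have int_F: "integrable ?N (\<lambda>x. (cmod (F x))\<^sup>2)"
      using cmod_step_transform_le[OF int_\<phi> id_meas]
      by (intro N.integrable_const_bound[where B="(LINT t|?M. cmod (\<phi> t))\<^sup>2"])
        (auto simp: F_def intro!: power_mono)
    \<comment> \<open>Strictness comes from injectivity: a vanishing transform would force
      \<open>\<phi>\<close> to vanish almost everywhere.\<close>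
    have "(LINT x|?N. (cmod (F x))\<^sup>2) \<noteq> 0"
    proof
      assume "(LINT x|?N. (cmod (F x))\<^sup>2) = 0"
      then have F0: "AE x in ?N. F x = 0"
        using integral_nonneg_eq_0_iff_AE[OF int_F] by simp
      define f where "f = (\<lambda>t. indicator ?S t *\<^sub>R \<phi> t)"
      have "AE t in lebesgue. f t = 0"
      proof (rule AE_zero_if_step_transform_zero[where a=a])
        show "integrable lebesgue f"
          using int_\<phi> unfolding f_def by (subst (asm) integrable_restrict_space) auto
        show "f t = 0" if "a \<le> \<bar>t\<bar>" for t using that by (auto simp: f_def indicator_def)
        have "F x = (LINT t|lebesgue. f t * of_real (step t x))" for x
          unfolding F_def f_def by (subst integral_restrict_space) auto
        then show "AE x in ?N. (LINT t|lebesgue. f t * of_real (step t x)) = 0"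
          using F0 by simp
      qed (rule a)
      then have "AE t in ?M. \<phi> t = 0"
        by (subst AE_restrict_space_iff) (auto simp: f_def elim!: eventually_mono)
      with nz show False by simp
    qed
    moreover have "0 \<le> (LINT x|?N. (cmod (F x))\<^sup>2)" by simp
    ultimately have "0 < (LINT x|?N. (cmod (F x))\<^sup>2)" by linarith
    then have "0 < complex_of_real (LINT x|?N. (cmod (F x))\<^sup>2)"
      by (simp only: less_complex_def Re_complex_of_real Im_complex_of_real zero_complex.sel)
    then show "0 < (LINT t|?M. LINT u|?M. screw_kernel screw_g t u * \<phi> u * cnj (\<phi> t))"
      using le by (rule less_le_trans)
  qed
  moreover have "restrict screw_g {- 2 * a..2 * a} \<in> screw_class (ereal a)" if a: "0 < a" "a < a\<^sub>0" for a
  proof -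
    let ?h = "restrict screw_g {- 2 * a..2 * a}"
    have ereal_lt: "ereal \<bar>t\<bar> < 2 * ereal a \<longleftrightarrow> \<bar>t\<bar> < 2 * a" for t
      using times_ereal.simps(1)[of 2 a] by (simp del: times_ereal.simps)
    \<comment> \<open>\<open>restrict\<close> gives the value \<open>undefined\<close> outside the
      closed interval, but only the open interval enters the class.\<close>
    have h: "?h t = of_real (full_screw \<kappa> t + c)" if "\<bar>t\<bar> < 2 * a" for t
      using that a g[of t] by (auto simp: a\<^sub>0_def)
    have "continuous_on {t. \<bar>t\<bar> < 2 * a} (\<lambda>t. complex_of_real (full_screw \<kappa> t + c))"
      by (intro continuous_intros continuous_on_subset[OF continuous_on_full_screw]) auto
    then have "continuous_on {t. \<bar>t\<bar> < 2 * a} ?h"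
      by (rule continuous_on_eq) (simp only: mem_Collect_eq h)
    moreover have "?h (- t) = cnj (?h t)" if "\<bar>t\<bar> < 2 * a" for t
    proof -
      have "?h (- t) = of_real (full_screw \<kappa> (- t) + c)"
        by (rule h) (use that in simp)
      then show ?thesis
        unfolding h[OF that] by (simp only:) (simp add: full_screw_def)
    qed
    moreover have "0 \<le> (\<Sum>i=1..n. \<Sum>j=1..n. screw_kernel ?h (t i) (t j) * \<xi> i * cnj (\<xi> j))"
      if t: "\<forall>i\<in>{1..n}. \<bar>t i\<bar> < a" for n :: nat and t \<xi>
    proof -
      \<comment> \<open>Point masses turn the integrals into finite sums. The weights are the
        conjugates of \<open>\<xi>\<close>, since the class conjugates the weight of the second
        argument and the form that of the first.\<close>
      let ?M = "count_space {1..n}"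
      have "0 \<le> complex_of_real (LINT x|restrict_space lborel {-a..a}.
          (cmod (LINT i|?M. cnj (\<xi> i) * of_real (step (t i) x)))\<^sup>2)"
        by (simp add: less_eq_complex_def)
      also have "\<dots> \<le> (LINT i|?M. LINT j|?M.
          of_real (real_screw_kernel (full_screw \<kappa>) (t i) (t j)) * cnj (\<xi> j) * cnj (cnj (\<xi> i)))"
        by (rule nat_form[OF a(1)])
          (use a t in \<open>auto simp: a\<^sub>0_def less_imp_le sigma_finite_measure_count_space_finite integrable_count_space\<close>)
      also have "\<dots> = (\<Sum>i=1..n. \<Sum>j=1..n. of_real (real_screw_kernel (full_screw \<kappa>) (t i) (t j)) * cnj (\<xi> j) * \<xi> i)"
        by (simp only: lebesgue_integral_count_space_finite finite_atLeastAtMost complex_cnj_cnj)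
      also have "\<dots> = (\<Sum>i=1..n. \<Sum>j=1..n. screw_kernel ?h (t i) (t j) * \<xi> i * cnj (\<xi> j))"
      proof (rule sum.cong[OF refl], rule sum.cong[OF refl])
        fix i j assume "i \<in> {1..n}" "j \<in> {1..n}"
        then have "screw_kernel ?h (t i) (t j) = of_real (real_screw_kernel (full_screw \<kappa>) (t i) (t j))"
          using t by (intro screw_kernel_eq_full_screw[OF h]) auto
        then show "of_real (real_screw_kernel (full_screw \<kappa>) (t i) (t j)) * cnj (\<xi> j) * \<xi> i
            = screw_kernel ?h (t i) (t j) * \<xi> i * cnj (\<xi> j)" by simp
      qed
      finally show ?thesis .
    qed
    ultimately show ?thesis
      unfolding screw_class_def by (auto simp: ereal_lt)
  qed
  moreover have "0 < a\<^sub>0" using a1 a2 by (simp add: a\<^sub>0_def)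
  ultimately show ?thesis by blast
qed

end
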